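(* Let $A\subset\mathbb{N}$ have positive upper $\log\log$ density $$\overline{\Delta}(A):=\limsup_{x\to\infty}\frac{1}{\log\log x}\sum_{\substack{n\in A\\ 1<n\le x}}\frac{1}{n\log n}>0.$$ Then there is an infinite L-divisibility chain $D\subset A$ such that $$\limsup_{y\to\infty}\frac{\#\{d\in D: d\le y\}}{\log\log y}\ \ge\ \frac{\overline{\Delta}(A)}{e^{\gamma}},$$ where $\gamma$ is the Euler–Mascheroni constant.
   Context: For an integer $a>1$ let $P(a)$ denote its largest prime factor, and define $\mathrm{L}_a=\{ba: b\in\mathbb{N},\ \text{every prime } p\mid b \text{ satisfies } p\ge P(a)\}$. An infinite sequence of integers $1<d_1<d_2<\cdots$ is an L-divisibility chain if $d_{j+1}\in\mathrm{L}_{d_j}$ for all $j\ge1$. *)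

theory Defs
  imports "HOL-Analysis.Analysis" "HOL-Computational_Algebra.Primes"
begin

definition P :: "nat \<Rightarrow> nat" where
  "P a = Max (prime_factors a)"

definition L :: "nat \<Rightarrow> nat set" where
  "L a = {b * a | b. b \<ge> 1 \<and> (\<forall>p. prime p \<and> p dvd b \<longrightarrow> p \<ge> P a)}"

definition L_chain :: "(nat \<Rightarrow> nat) \<Rightarrow> bool" where
  "L_chain d \<longleftrightarrow> 1 < d 0 \<and> strict_mono d \<and> (\<forall>j. d (Suc j) \<in> L (d j))"

definition upper_loglog_density :: "nat set \<Rightarrow> ereal" where
  "upper_loglog_density A =
     Limsup at_top (\<lambda>x::real. ereal ((\<Sum>n\<in>{n\<in>A. 1 < n \<and> real n \<le> x}. 1 / (real n * ln (real n)))
                                     / ln (ln x)))"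

end

theory Submission
  imports Defs "HOL-Probability.Probability" "HOL-Real_Asymp.Real_Asymp"
begin

text \<open>
  Choose independently for every prime \<open>p\<close> an exponent with the geometric distribution of
  parameter \<open>1 - 1/p\<close>, i.e. a random formal product of primes. The integers \<open>a\<close> that consist of the
  first few prime factors of this product, in increasing order, form an L-divisibility chain, and
  \<open>a\<close> occurs among them with probability \<open>1/a\<close> times the product of \<open>1 - 1/p\<close> over
  \<open>p < P a\<close>. By Mertens' third theorem this is at least \<open>(exp (-\<gamma>) - o(1)) / (a ln a)\<close>, so
  the expected number of chain members in \<open>A\<close> up to \<open>x\<close>, divided by \<open>ln ln x\<close>, has limsup at least the
  density of \<open>A\<close> over \<open>exp \<gamma>\<close>. These ratios are bounded in \<open>L\<^sup>2\<close>, hence uniformly integrable, and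
  reverse Fatou gives one outcome whose own limsup is that large.

  Only the upper half of Mertens' theorem is needed. It follows from \<open>\<zeta>(1 + \<delta>) \<sim> 1/\<delta>\<close> and
  the Euler product by Karamata's Tauberian method: the weights \<open>1/p\<close> at \<open>p powr -\<delta>\<close> and \<open>1/n\<close> at
  \<open>exp (-n/N)\<close> give the same limits for all polynomials vanishing at 0 and 1, and the
  cutoff function has a tight polynomial majorant.
\<close>

section \<open>The Euler product on the real axis\<close>

text \<open>The mean value theorem on \<open>[n + 1, n + 2]\<close>. Summed over \<open>n\<close>,
  the middle term telescopes, which compares the zeta series with \<open>1 / \<delta>\<close>
  without any integral.\<close>

lemma powr_diff_bounds:
  fixes \<delta> :: real and n :: nat
  assumes "\<delta> > 0"
  shows "\<delta> * real (Suc (Suc n)) powr -(1 + \<delta>) \<le> real (Suc n) powr -\<delta> - real (Suc (Suc n)) powr -\<delta>"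
    and "real (Suc n) powr -\<delta> - real (Suc (Suc n)) powr -\<delta> \<le> \<delta> * real (Suc n) powr -(1 + \<delta>)"
proof -
  let ?a = "real (Suc n)"
  let ?b = "real (Suc (Suc n))"
  have "\<exists>z. z > ?a \<and> z < ?b \<and> ?b powr -\<delta> - ?a powr -\<delta> = (?b - ?a) * (-\<delta> * z powr (-\<delta> - 1))"
    by (rule MVT2) (auto intro!: derivative_eq_intros simp: field_simps)
  then obtain z where z: "z > ?a" "z < ?b"
      "?b powr -\<delta> - ?a powr -\<delta> = (?b - ?a) * (-\<delta> * z powr (-\<delta> - 1))" by blast
  have eq: "?a powr -\<delta> - ?b powr -\<delta> = \<delta> * z powr -(1 + \<delta>)"
  proof -
    have "-(1 + \<delta>) = -\<delta> - 1" by simp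
    thus ?thesis using z(3) by (simp only: ) (simp add: algebra_simps)
  qed
  have "z powr -(1 + \<delta>) \<ge> ?b powr -(1 + \<delta>)" "z powr -(1 + \<delta>) \<le> ?a powr -(1 + \<delta>)"
    using z(1,2) assms by (auto intro!: powr_mono2')
  thus "\<delta> * ?b powr -(1 + \<delta>) \<le> ?a powr -\<delta> - ?b powr -\<delta>"
       "?a powr -\<delta> - ?b powr -\<delta> \<le> \<delta> * ?a powr -(1 + \<delta>)"
    unfolding eq using assms by (simp_all add: mult_left_mono)
qed

text \<open>An unordered sum, because the sieve below removes whole sets of indices.\<close>

definition zeta_real :: "real \<Rightarrow> real" where
  "zeta_real s = (\<Sum>\<^sub>\<infinity>n\<in>{0<..}. real n powr -s)"

lemma summable_powr_neg:
  fixes s :: real assumes "s > 1"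
  shows "summable (\<lambda>n. real n powr -s)"
  using assms summable_real_powr_iff[of "-s"] by simp

lemma zeta_has_sum_UNIV:
  assumes "s > 1"
  shows "((\<lambda>n. real n powr -s) has_sum zeta_real s) UNIV"
proof -
  have "((\<lambda>n. real n powr -s) has_sum (\<Sum>n. real n powr -s)) UNIV"
    by (rule sums_nonneg_imp_has_sum) (use summable_powr_neg[OF assms] in auto)
  hence "(\<lambda>n. real n powr -s) summable_on UNIV" by (auto simp: summable_on_def)
  hence 1: "((\<lambda>n. real n powr -s) has_sum (infsum (\<lambda>n. real n powr -s) UNIV)) UNIV" by simp
  have "infsum (\<lambda>n. real n powr -s) UNIV = zeta_real s"
    unfolding zeta_real_def by (rule infsum_cong_neutral) auto
  with 1 show ?thesis by simp
qed

lemma zeta_sums: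
  assumes "s > 1" shows "(\<lambda>n. real n powr -s) sums zeta_real s"
  using has_sum_imp_sums[OF zeta_has_sum_UNIV[OF assms]] .

text \<open>The telescoping differences sum to 1. Bounding them from above meets the whole zeta
  series; bounding them from below meets it without its first term 1, which costs the extra
  \<open>\<delta>\<close>.\<close>

lemma zeta_bounds:
  assumes "\<delta> > 0"
  shows "1 \<le> \<delta> * zeta_real (1 + \<delta>)" "\<delta> * zeta_real (1 + \<delta>) \<le> 1 + \<delta>"
proof -
  have "(\<lambda>n. real n powr -(1+\<delta>)) sums zeta_real (1+\<delta>)" using assms by (intro zeta_sums) auto
  hence s1: "(\<lambda>n. real (Suc n) powr -(1+\<delta>)) sums zeta_real (1+\<delta>)"
    by (subst sums_Suc_iff) simp
  hence s2: "(\<lambda>n. real (Suc (Suc n)) powr -(1+\<delta>)) sums (zeta_real (1+\<delta>) - 1)"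
    by (subst sums_Suc_iff) simp
  have "(\<lambda>n. real (Suc n) powr -\<delta>) \<longlonglongrightarrow> 0" using assms by real_asymp
  hence t: "(\<lambda>n. real (Suc n) powr -\<delta> - real (Suc (Suc n)) powr -\<delta>) sums (1 - 0)"
    using telescope_sums'[of "\<lambda>n. real (Suc n) powr -\<delta>" 0] by simp
  show "1 \<le> \<delta> * zeta_real (1 + \<delta>)"
    using sums_le[OF powr_diff_bounds(2)[OF assms] t sums_mult[OF s1]] by simp
  have "\<delta> * (zeta_real (1+\<delta>) - 1) \<le> 1"
    using sums_le[OF powr_diff_bounds(1)[OF assms] sums_mult[OF s2] t] by simp
  thus "\<delta> * zeta_real (1 + \<delta>) \<le> 1 + \<delta>" by (simp add: algebra_simps)
qed

lemma zeta_real_pos: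
  assumes "\<delta> > 0" shows "zeta_real (1 + \<delta>) > 0"
  using zeta_bounds(1)[OF assms] assms by (smt (verit, best) mult_nonneg_nonpos)

lemma zeta_times_tendsto: "((\<lambda>\<delta>. \<delta> * zeta_real (1 + \<delta>)) \<longlongrightarrow> 1) (at_right 0)"
proof (rule tendsto_sandwich)
  show "\<forall>\<^sub>F \<delta> in at_right 0. 1 \<le> \<delta> * zeta_real (1 + \<delta>)"
       "\<forall>\<^sub>F \<delta> in at_right 0. \<delta> * zeta_real (1 + \<delta>) \<le> 1 + \<delta>"
    by (auto simp: eventually_at_right_field intro!: exI[of _ 1] zeta_bounds)
  show "((\<lambda>\<delta>. 1 + \<delta>) \<longlongrightarrow> 1) (at_right (0::real))" by (auto intro!: tendsto_eq_intros)
qed auto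

text \<open>The index 0 is kept in all index sets; it contributes nothing because \<^term>\<open>0 powr s = 0\<close>.\<close>

lemma zeta_sieve:
  assumes s: "s > 1" and S: "finite S" "\<And>p. p \<in> S \<Longrightarrow> prime p"
  shows "((\<lambda>n. real n powr -s) has_sum (zeta_real s * (\<Prod>p\<in>S. 1 - real p powr -s)))
           {n. \<forall>p\<in>S. \<not> p dvd n \<or> n = 0}"
  using S
proof (induction S rule: finite_induct)
  case empty
  show ?case using zeta_has_sum_UNIV[OF s] by simp
next
  case (insert q S)
  define U where "U = {n. \<forall>p\<in>S. \<not> p dvd n \<or> n = (0::nat)}"
  define Z where "Z = zeta_real s * (\<Prod>p\<in>S. 1 - real p powr -s)"
  have q: "prime q" using insert by auto
  hence q0: "q > 0" by (simp add: prime_gt_0_nat)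
  have IH: "((\<lambda>n. real n powr -s) has_sum Z) U"
    unfolding U_def Z_def using insert by auto
  \<comment> \<open>One round of the sieve of Eratosthenes: the multiples of \<open>q\<close> in
    \<open>U\<close> are exactly \<open>q * U\<close>, with sum \<open>q powr -s\<close> times that
    over \<open>U\<close>. Removing them produces the new factor.\<close>
  have "((\<lambda>n. real q powr -s * real n powr -s) has_sum (real q powr -s * Z)) U"
    by (rule has_sum_cmult_right[OF IH])
  also have "?this \<longleftrightarrow> (((\<lambda>n. real n powr -s) \<circ> (\<lambda>n. q * n)) has_sum (real q powr -s * Z)) U"
    by (rule has_sum_cong) (simp add: powr_mult)
  also have "\<dots> \<longleftrightarrow> ((\<lambda>n. real n powr -s) has_sum (real q powr -s * Z)) ((\<lambda>n. q * n) ` U)"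
    by (rule has_sum_reindex[symmetric]) (use q0 in \<open>auto simp: inj_on_def\<close>)
  finally have 2: "((\<lambda>n. real n powr -s) has_sum (real q powr -s * Z)) ((\<lambda>n. q * n) ` U)" .
  have nd: "\<not> p dvd q" if "p \<in> S" for p
    using that insert(2,4) q primes_dvd_imp_eq[of p q] by auto
  have sub: "(\<lambda>n. q * n) ` U \<subseteq> U"
    using nd insert(4) q by (fastforce simp: U_def prime_dvd_mult_iff)
  have 3: "((\<lambda>n. real n powr -s) has_sum (Z - real q powr -s * Z)) (U - (\<lambda>n. q * n) ` U)"
    by (rule has_sum_Diff[OF IH 2 sub])
  have img: "(\<lambda>n. q * n) ` U = {n\<in>U. q dvd n}"
  proof (intro equalityI subsetI)
    fix n assume "n \<in> {n\<in>U. q dvd n}"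
    then obtain m where m: "n = q * m" "n \<in> U" by (auto elim!: dvdE)
    hence "m \<in> U" using q0 by (fastforce simp: U_def)
    thus "n \<in> (\<lambda>n. q * n) ` U" using m by auto
  qed (use sub in auto)
  have "((\<lambda>n. real n powr -s) has_sum (Z - real q powr -s * Z)) {n. \<forall>p\<in>insert q S. \<not> p dvd n \<or> n = 0}"
  proof (rule has_sum_cong_neutral[THEN iffD1, OF _ _ _ 3])
    fix n assume "n \<in> {n. \<forall>p\<in>insert q S. \<not> p dvd n \<or> n = 0} - (U - (\<lambda>n. q * n) ` U)"
    thus "real n powr -s = 0" unfolding img by (auto simp: U_def)
  next
    fix n assume "n \<in> (U - (\<lambda>n. q * n) ` U) - {n. \<forall>p\<in>insert q S. \<not> p dvd n \<or> n = 0}"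
    thus "real n powr -s = 0" unfolding img by (auto simp: U_def)
  qed auto
  moreover have "Z - real q powr -s * Z = zeta_real s * (\<Prod>p\<in>insert q S. 1 - real p powr -s)"
    using insert by (simp add: Z_def algebra_simps)
  ultimately show ?case by simp
qed

lemma prime_powr_le_half:
  assumes "s \<ge> 1" "prime (p::nat)"
  shows "real p powr -s \<le> 1/2"
proof -
  have "real p powr -s \<le> 2 powr -s" using assms prime_ge_2_nat[of p] by (intro powr_mono2') auto
  also have "\<dots> \<le> 2 powr -1" using assms by (intro powr_mono) auto
  finally show ?thesis by (simp add: powr_minus)
qed

text \<open>The sieved sum \<open>T N\<close> tends to 1: it keeps the index 1, and any other
  positive index below \<open>N\<close> has a prime factor below \<open>N\<close>, so the rest is at
  most a tail of the zeta series. Logarithms turn this into a convergent sum.\<close>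

lemma euler_product_ln:
  assumes s: "s > 1"
  shows "(\<lambda>n. if prime n then - ln (1 - real n powr -s) else 0) sums ln (zeta_real s)"
proof -
  define Pr where "Pr = (\<lambda>N. {p::nat. prime p \<and> p < N})"
  have fin: "finite (Pr N)" for N by (simp add: Pr_def)
  have z1: "zeta_real s > 0" using zeta_real_pos[of "s - 1"] s by simp
  define T where "T = (\<lambda>N. zeta_real s * (\<Prod>p\<in>Pr N. 1 - real p powr -s))"
  have hs: "((\<lambda>n. real n powr -s) has_sum T N) {n. \<forall>p\<in>Pr N. \<not> p dvd n \<or> n = 0}" for N
    unfolding T_def by (rule zeta_sieve[OF s fin]) (auto simp: Pr_def)
  have lower: "1 \<le> T N" for N
  proof -
    have "((\<lambda>n. real n powr -s) has_sum (\<Sum>n\<in>{1}. real n powr -s)) {1}" by (intro has_sum_finite) auto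
    hence "(\<Sum>n\<in>{1}. real n powr -s) \<le> T N"
      by (rule has_sum_mono2[OF _ hs[of N]]) (auto simp: Pr_def)
    thus ?thesis by simp
  qed
  have upper: "T N \<le> 1 + (zeta_real s - (\<Sum>n<N. real n powr -s))" for N
  proof -
    have "((\<lambda>n. real n powr -s) has_sum (\<Sum>n\<in>{..<N}. real n powr -s)) {..<N}" by (intro has_sum_finite) auto
    from has_sum_Diff[OF zeta_has_sum_UNIV[OF s] this]
    have d: "((\<lambda>n. real n powr -s) has_sum (zeta_real s - (\<Sum>n<N. real n powr -s))) (UNIV - {..<N})" by auto
    have "((\<lambda>n. if n = 1 then 1 else 0) has_sum (\<Sum>n\<in>{1::nat}. if n = 1 then 1 else (0::real))) {1::nat}"
      by (intro has_sum_finite) auto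
    hence "((\<lambda>n. if n = 1 then 1 else 0) has_sum (1::real)) (UNIV::nat set)"
      by (subst has_sum_cong_neutral[where T = "{1}" and g = "\<lambda>n. if n = 1 then 1 else 0"]) auto
    moreover have "((\<lambda>n. if n \<in> UNIV - {..<N} then real n powr -s else 0) has_sum (zeta_real s - (\<Sum>n<N. real n powr -s))) UNIV"
      by (rule has_sum_cong_neutral[THEN iffD1, OF _ _ _ d]) auto
    ultimately have e: "((\<lambda>n. (if n = 1 then 1 else 0) + (if n \<in> UNIV - {..<N} then real n powr -s else 0)) has_sum
       (1 + (zeta_real s - (\<Sum>n<N. real n powr -s)))) UNIV"
      by (rule has_sum_add)
    show ?thesis
    proof (rule has_sum_mono_neutral[OF hs[of N] e], goal_cases)
      case (1 n)
      show ?case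
      proof (cases "n = 0 \<or> n = 1 \<or> n \<ge> N")
        case False
        then obtain p where "prime p" "p dvd n" using prime_factor_nat[of n] by auto
        hence "p \<in> Pr N" using False dvd_imp_le[of p n] by (auto simp: Pr_def)
        thus ?thesis using 1 \<open>p dvd n\<close> False by auto
      qed auto
    qed auto
  qed
  have "(\<lambda>N. 1 + (zeta_real s - (\<Sum>n<N. real n powr -s))) \<longlonglongrightarrow> 1 + (zeta_real s - zeta_real s)"
    using zeta_sums[OF s] unfolding sums_def by (intro tendsto_intros)
  hence "T \<longlonglongrightarrow> 1"
    by (intro tendsto_sandwich[of "\<lambda>_. 1" T _ "\<lambda>N. 1 + (zeta_real s - (\<Sum>n<N. real n powr -s))"])
       (auto simp: lower upper)
  hence "(\<lambda>N. ln (zeta_real s) - ln (T N)) \<longlonglongrightarrow> ln (zeta_real s) - ln 1"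
    by (intro tendsto_intros) auto
  moreover have "ln (zeta_real s) - ln (T N) = (\<Sum>n<N. if prime n then - ln (1 - real n powr -s) else 0)" for N
  proof -
    have pos: "1 - real p powr -s > 0" if "p \<in> Pr N" for p
      using prime_powr_le_half[of s p] that s by (auto simp: Pr_def)
    have "ln (T N) = ln (zeta_real s) + (\<Sum>p\<in>Pr N. ln (1 - real p powr -s))"
    proof -
      have "(\<Prod>p\<in>Pr N. 1 - real p powr -s) > 0" using pos by (intro prod_pos) auto
      moreover have "ln (\<Prod>p\<in>Pr N. 1 - real p powr -s) = (\<Sum>p\<in>Pr N. ln (1 - real p powr -s))"
        using pos by (intro ln_prod fin) fastforce
      ultimately show ?thesis unfolding T_def using z1 by (simp add: ln_mult_pos)
    qed
    moreover have "(\<Sum>n<N. if prime n then - ln (1 - real n powr -s) else 0) = (\<Sum>p\<in>Pr N. - ln (1 - real p powr -s))"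
      by (rule sum.mono_neutral_cong_right) (auto simp: Pr_def)
    ultimately show ?thesis by (simp add: sum_negf)
  qed
  ultimately show ?thesis unfolding sums_def by simp
qed

section \<open>Karamata's method\<close>

text \<open>Linearity, since \<open>u * (1 - u) * u ^ j = u ^ Suc j - u ^ Suc (Suc j)\<close>.
  Differences are needed because, for the weights \<open>1 / n\<close> and \<open>1 / p\<close> used
  below, the sum of a single power diverges in the limit. The limit depends on the coefficients
  \<open>a\<close> alone, not on \<open>w\<close> and \<open>u\<close>.\<close>

lemma karamata_polynomial:
  fixes w u :: "'i \<Rightarrow> nat \<Rightarrow> real" and a :: "nat \<Rightarrow> real"
  assumes smb: "\<And>k. k \<ge> 1 \<Longrightarrow> \<forall>\<^sub>F i in F. summable (\<lambda>n. w i n * (u i n ^ k - u i n ^ Suc k))"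
    and lim: "\<And>k. k \<ge> 1 \<Longrightarrow>
      ((\<lambda>i. \<Sum>n. w i n * (u i n ^ k - u i n ^ Suc k)) \<longlongrightarrow> ln (real (Suc k)) - ln (real k)) F"
  shows "\<forall>\<^sub>F i in F. summable (\<lambda>n. w i n * (u i n * (1 - u i n) * (\<Sum>j\<le>m. a j * u i n ^ j)))"
    and "((\<lambda>i. \<Sum>n. w i n * (u i n * (1 - u i n) * (\<Sum>j\<le>m. a j * u i n ^ j)))
           \<longlongrightarrow> (\<Sum>j\<le>m. a j * (ln (real (Suc (Suc j))) - ln (real (Suc j))))) F"
proof -
  let ?t = "\<lambda>i j n. w i n * (u i n ^ Suc j - u i n ^ Suc (Suc j))"
  have eq: "w i n * (u i n * (1 - u i n) * (\<Sum>j\<le>m. a j * u i n ^ j)) = (\<Sum>j\<le>m. a j * ?t i j n)" for i n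
    by (simp add: sum_distrib_left algebra_simps sum_subtractf)
  have "\<forall>\<^sub>F i in F. \<forall>j\<in>{..m}. summable (?t i j)"
    by (intro eventually_ball_finite ballI smb) auto
  hence ev: "\<forall>\<^sub>F i in F. (\<lambda>n. w i n * (u i n * (1 - u i n) * (\<Sum>j\<le>m. a j * u i n ^ j))) sums
      (\<Sum>j\<le>m. a j * suminf (?t i j))"
    by eventually_elim (unfold eq, intro sums_sum sums_mult summable_sums, auto)
  thus "\<forall>\<^sub>F i in F. summable (\<lambda>n. w i n * (u i n * (1 - u i n) * (\<Sum>j\<le>m. a j * u i n ^ j)))"
    by eventually_elim (auto simp: sums_iff)
  have "((\<lambda>i. \<Sum>j\<le>m. a j * suminf (?t i j)) \<longlongrightarrow> (\<Sum>j\<le>m. a j * (ln (real (Suc (Suc j))) - ln (real (Suc j))))) F"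
    by (intro tendsto_sum tendsto_mult tendsto_const lim) auto
  thus "((\<lambda>i. \<Sum>n. w i n * (u i n * (1 - u i n) * (\<Sum>j\<le>m. a j * u i n ^ j)))
           \<longlongrightarrow> (\<Sum>j\<le>m. a j * (ln (real (Suc (Suc j))) - ln (real (Suc j))))) F"
    by (rule Lim_transform_eventually) (use ev in eventually_elim, auto simp: sums_iff)
qed

text \<open>
  With \<open>u = p powr (-1 / ln x)\<close> the condition \<open>exp (-1) \<le> u\<close> says \<open>p \<le> x\<close>.
\<close>

definition cutoff :: "real \<Rightarrow> real" where
  "cutoff u = (if exp (-1) \<le> u then 1 else 0) - u"

text \<open>Divided by \<open>u * (1 - u)\<close>, the cutoff is \<open>1 / u\<close> to the right
  of \<open>exp (-1)\<close> and \<open>- 1 / (1 - u)\<close> to the left; the term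
  \<open>- u\<close> in \<open>cutoff\<close> makes it vanish at 1, so the quotient stays bounded. A
  linear ramp on a short interval removes the jump, and a Weierstrass approximation of the result,
  shifted up by \<open>\<epsilon> / 2\<close>, lies above it.\<close>

lemma cutoff_polynomial_majorant:
  assumes e: "0 < \<epsilon>" "\<epsilon> \<le> 1"
  obtains a :: "nat \<Rightarrow> real" and m where
    "\<And>u. 0 \<le> u \<Longrightarrow> u \<le> 1 \<Longrightarrow> cutoff u \<le> u * (1 - u) * (\<Sum>j\<le>m. a j * u ^ j)"
    "\<And>u. 0 \<le> u \<Longrightarrow> u \<le> 1 \<Longrightarrow> u * (1 - u) * (\<Sum>j\<le>m. a j * u ^ j) \<le>
       cutoff u + \<epsilon> * (u * (1 - u)) + (if exp (-(1 + \<epsilon>)) < u \<and> u < exp (-1) then 3 else 0)"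
proof -
  define c :: real where "c = exp (-1)"
  define b where "b = exp (-(1 + \<epsilon>))"
  have c: "0 < c" "c \<le> 1/2" "1 / c \<le> 3"
    using exp_ge_add_one_self[of "1::real"] exp_le
    by (auto simp: c_def exp_minus field_simps)
  have b: "0 < b" "b < c" using e by (auto simp: b_def c_def)
  \<comment> \<open>The height of the jump at \<open>c\<close> that the ramp \<open>t\<close> has to
    bridge, from \<open>- 1 / (1 - c)\<close> up to \<open>1 / c\<close>.\<close>
  define K where "K = 1 / c + 1 / (1 - c)"
  have K: "0 \<le> K" "K \<le> 5"
  proof -
    have "1 / (1 - c) \<le> 2" using c by (simp add: field_simps)
    thus "K \<le> 5" using c by (simp add: K_def)
    show "0 \<le> K" using c by (simp add: K_def)
  qed
  define t where "t = (\<lambda>u. max 0 ((u - b) / (c - b)))"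
  define k where "k = (\<lambda>u. if u \<le> c then - 1 / (1 - u) + t u * K else 1 / u)"
  have cont: "continuous_on {0..1} k"
    unfolding k_def
  proof (rule continuous_on_cases_le[where h = "\<lambda>x. x" and a = c])
    show "continuous_on {t \<in> {0..1}. t \<le> c} (\<lambda>u. - 1 / (1 - u) + t u * K)"
      unfolding t_def using c b by (intro continuous_intros) auto
    show "continuous_on {t \<in> {0..1}. c \<le> t} (\<lambda>u. 1 / u)"
      using c by (intro continuous_intros) auto
    fix x assume "x \<in> {0..1}" "x = c"
    thus "- 1 / (1 - x) + t x * K = 1 / x" using c b by (simp add: t_def K_def)
  qed auto
  have "continuous_on {0..1} (\<lambda>u. k u + \<epsilon> / 2)" by (intro continuous_intros cont)
  then obtain g where g: "real_polynomial_function g" "\<And>u. u \<in> {0..1} \<Longrightarrow> \<bar>k u + \<epsilon> / 2 - g u\<bar> < \<epsilon> / 2"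
    using Stone_Weierstrass_real_polynomial_function[of "{0..1}" "\<lambda>u. k u + \<epsilon> / 2" "\<epsilon> / 2"] e by auto
  then obtain a m where am: "g = (\<lambda>x. \<Sum>j\<le>m. a j * x ^ j)"
    using real_polynomial_function_iff_sum by auto
  have g': "k u \<le> g u" "g u \<le> k u + \<epsilon>" if "0 \<le> u" "u \<le> 1" for u
    using g(2)[of u] that unfolding abs_less_iff by auto
  have main: "cutoff u \<le> u * (1 - u) * g u \<and> u * (1 - u) * g u \<le> 
       cutoff u + \<epsilon> * (u * (1 - u)) + (if b < u \<and> u < c then 3 else 0)" if u: "0 \<le> u" "u \<le> 1" for u
  proof -
    have uu: "0 \<le> u * (1 - u)" using u by simp
    have quarter: "u * (1 - u) \<le> 1 / 4"
      using zero_le_power2[of "u - 1/2"] by (simp add: power2_eq_square algebra_simps)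
    have lo: "u * (1 - u) * k u \<le> u * (1 - u) * g u" using g'(1)[OF u] uu by (rule mult_left_mono)
    have up: "u * (1 - u) * g u \<le> u * (1 - u) * (k u + \<epsilon>)" using g'(2)[OF u] uu by (rule mult_left_mono)
    consider "u \<ge> c" | "u \<le> b" | "b < u" "u < c" by linarith
    thus ?thesis
    proof cases
      case 1
      have ku: "u * (1 - u) * k u = cutoff u"
      proof (cases "u = c")
        case True
        have "t c = 1" using b by (simp add: t_def)
        hence "k u = 1 / u" using True c by (simp add: k_def K_def)
        thus ?thesis using 1 c by (simp add: cutoff_def c_def field_simps)
      next
        case False
        thus ?thesis using 1 c by (simp add: k_def cutoff_def c_def field_simps)
      qed
      have "u * (1 - u) * (k u + \<epsilon>) = cutoff u + \<epsilon> * (u * (1 - u))" unfolding distrib_left ku by simp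
      thus ?thesis using lo up 1 unfolding ku by simp
    next
      case 2
      have "t u = 0" using 2 b by (simp add: t_def divide_nonpos_pos)
      hence ku: "u * (1 - u) * k u = cutoff u"
        using 2 b c by (simp add: k_def cutoff_def c_def[symmetric] field_simps)
      have "u * (1 - u) * (k u + \<epsilon>) = cutoff u + \<epsilon> * (u * (1 - u))" unfolding distrib_left ku by simp
      thus ?thesis using lo up 2 unfolding ku by simp
    next
      case 3
      have t: "0 \<le> t u" "t u \<le> 1" using 3 by (auto simp: t_def field_simps)
      have k: "k u = - 1 / (1 - u) + t u * K" using 3 by (simp add: k_def)
      have cut: "cutoff u = - u" using 3 by (simp add: cutoff_def c_def)
      have ku: "u * (1 - u) * k u = cutoff u + u * (1 - u) * (t u * K)"
        using 3 c unfolding k cut by (simp add: field_simps)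
      \<comment> \<open>On the ramp the excess is at most \<open>5 / 4\<close>, from
        \<open>K \<le> 5\<close> and \<open>u * (1 - u) \<le> 1 / 4\<close>; the 3 in the statement
        is generous.\<close>
      have "t u * K \<le> 1 * 5" using t K by (intro mult_mono) auto
      hence "u * (1 - u) * (t u * K) \<le> 1 / 4 * 5" using quarter uu t K by (intro mult_mono) auto
      moreover have "0 \<le> u * (1 - u) * (t u * K)" using uu t K by simp
      moreover have "u * (1 - u) * (k u + \<epsilon>) = u * (1 - u) * k u + \<epsilon> * (u * (1 - u))"
        unfolding distrib_left by simp
      ultimately have "cutoff u \<le> u * (1 - u) * g u" "u * (1 - u) * g u \<le> cutoff u + \<epsilon> * (u * (1 - u)) + 3"
        using lo up ku by linarith+
      thus ?thesis using 3 by simp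
    qed
  qed
  show thesis
    by (rule that[of a m]) (use main in \<open>auto simp: am b_def c_def\<close>)
qed

section \<open>The comparison weights \<open>1 / n\<close> at the points
  \<open>exp (-n/N)\<close>\<close>

lemma ln_one_minus_sums:
  assumes "0 \<le> y" "y < 1"
  shows "(\<lambda>n. y ^ n / real n) sums - ln (1 - y)"
proof -
  have "(\<lambda>n. - ((- (- y)) ^ n) / of_nat n) sums ln (1 + (- y))"
    using assms by (intro ln_series') auto
  from sums_minus[OF this] show ?thesis by simp
qed

lemma exp_weights_sums:
  assumes "N > 0" "k > 0"
  shows "(\<lambda>n. 1 / real n * exp (- real n / real N) ^ k) sums - ln (1 - exp (- real k / real N))"
proof -
  have "exp (- real k / real N) ^ n = exp (- real n / real N) ^ k" for n
    by (simp add: exp_of_nat_mult[symmetric] mult.commute)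
  thus ?thesis using ln_one_minus_sums[of "exp (- real k / real N)"] assms
    by simp
qed

text \<open>\<open>- ln (1 - exp (-k/N))\<close> is \<open>ln N - ln k + o(1)\<close>, so
  \<open>ln N\<close> cancels in the difference of two powers.\<close>

lemma exp_weights_karamata:
  assumes "k \<ge> 1"
  shows "\<forall>\<^sub>F N in sequentially. summable (\<lambda>n. 1 / real n * (exp (- real n / real N) ^ k - exp (- real n / real N) ^ Suc k))"
    and "((\<lambda>N. \<Sum>n. 1 / real n * (exp (- real n / real N) ^ k - exp (- real n / real N) ^ Suc k))
      \<longlongrightarrow> ln (real (Suc k)) - ln (real k)) sequentially"
proof -
  have ev: "\<forall>\<^sub>F N in sequentially. (\<lambda>n. 1 / real n * (exp (- real n / real N) ^ k - exp (- real n / real N) ^ Suc k)) sums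
     (- ln (1 - exp (- real k / real N)) - - ln (1 - exp (- real (Suc k) / real N)))"
    using eventually_gt_at_top[of 0]
  proof eventually_elim
    case (elim N)
    show ?case unfolding right_diff_distrib
      by (intro sums_diff exp_weights_sums) (use elim assms in auto)
  qed
  thus "\<forall>\<^sub>F N in sequentially. summable (\<lambda>n. 1 / real n * (exp (- real n / real N) ^ k - exp (- real n / real N) ^ Suc k))"
    by eventually_elim (auto simp: sums_iff)
  define r where "r = real k"
  have r: "r > 0" using assms by (simp add: r_def)
  have "((\<lambda>N. - ln (1 - exp (- r / real N)) - - ln (1 - exp (- (r + 1) / real N))) \<longlongrightarrow> ln (r + 1) - ln r) sequentially"
    using r by real_asymp
  hence "((\<lambda>N. - ln (1 - exp (- real k / real N)) - - ln (1 - exp (- real (Suc k) / real N))) \<longlongrightarrow> ln (real (Suc k)) - ln (real k)) sequentially"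
    by (simp add: r_def algebra_simps)
  thus "((\<lambda>N. \<Sum>n. 1 / real n * (exp (- real n / real N) ^ k - exp (- real n / real N) ^ Suc k))
      \<longlongrightarrow> ln (real (Suc k)) - ln (real k)) sequentially"
    by (rule Lim_transform_eventually) (use ev in eventually_elim, auto simp: sums_iff)
qed

text \<open>At \<open>u = exp (-n/N)\<close> the cutoff condition reads \<open>n \<le> N\<close>, so
  the indicator contributes \<open>harm N\<close> and the term \<open>- u\<close> the logarithmic
  series.\<close>

lemma exp_weights_cutoff_sums:
  assumes "N > 0"
  shows "(\<lambda>n. 1 / real n * cutoff (exp (- real n / real N))) sums
          (harm N + ln (1 - exp (- 1 / real N)))"
proof -
  have 1: "(\<lambda>n. if n \<in> {1..N} then 1 / real n else 0) sums (\<Sum>n\<in>{1..N}. 1 / real n)"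
    by (rule sums_If_finite_set) auto
  have 2: "(\<lambda>n. 1 / real n * exp (- real n / real N)) sums - ln (1 - exp (- 1 / real N))"
    using exp_weights_sums[of N 1] assms by simp
  have "(\<lambda>n. (if n \<in> {1..N} then 1 / real n else 0) - 1 / real n * exp (- real n / real N))
      sums ((\<Sum>n\<in>{1..N}. 1 / real n) - - ln (1 - exp (- 1 / real N)))"
    by (intro sums_diff 1 2)
  moreover have "(if n \<in> {1..N} then 1 / real n else 0) - 1 / real n * exp (- real n / real N) =
     1 / real n * cutoff (exp (- real n / real N))" for n
    using assms by (cases "n = 0") (auto simp: cutoff_def field_simps)
  ultimately show ?thesis by (simp add: harm_def inverse_eq_divide)
qed

text \<open>
  The limit functional of \<open>karamata_polynomial\<close> depends only on the polynomial, so it can be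
  evaluated on the weights \<open>1/n\<close> at the points \<open>exp (-n/N)\<close>, where the cutoff sum is
  \<^term>\<open>harm N - ln (real N)\<close> up to \<open>o(1)\<close>. This is where the Euler--Mascheroni constant comes from.
\<close>

lemma karamata_limit_le:
  fixes a :: "nat \<Rightarrow> real"
  assumes e: "0 < \<epsilon>"
    and up: "\<And>u. 0 \<le> u \<Longrightarrow> u \<le> 1 \<Longrightarrow> u * (1 - u) * (\<Sum>j\<le>m. a j * u ^ j) \<le>
       cutoff u + \<epsilon> * (u * (1 - u)) + (if exp (-(1 + \<epsilon>)) < u \<and> u < exp (-1) then 3 else 0)"
  shows "(\<Sum>j\<le>m. a j * (ln (real (Suc (Suc j))) - ln (real (Suc j)))) \<le> euler_mascheroni + 4 * \<epsilon>"
proof -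
  define u where "u = (\<lambda>N n. exp (- real n / real N))"
  let ?q = "\<lambda>u. u * (1 - u) * (\<Sum>j\<le>m. a j * u ^ j)"
  have ek: "\<forall>\<^sub>F N in sequentially. summable (\<lambda>n. 1 / real n * (u N n ^ k - u N n ^ Suc k))"
     "(\<lambda>N. \<Sum>n. 1 / real n * (u N n ^ k - u N n ^ Suc k)) \<longlonglongrightarrow> ln (real (Suc k)) - ln (real k)" if "k \<ge> 1" for k
    unfolding u_def using exp_weights_karamata[OF that] by simp_all
  have K: "\<forall>\<^sub>F N in sequentially. summable (\<lambda>n. 1 / real n * ?q (u N n))"
     "(\<lambda>N. \<Sum>n. 1 / real n * ?q (u N n)) \<longlonglongrightarrow> (\<Sum>j\<le>m. a j * (ln (real (Suc (Suc j))) - ln (real (Suc j))))"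
    by (rule karamata_polynomial[where w = "\<lambda>_ n. 1 / real n" and u = u]; use ek in blast)+
  have lim2: "(\<lambda>N. \<Sum>n. 1 / real n * (u N n ^ 1 - u N n ^ Suc 1)) \<longlonglongrightarrow> ln (real (Suc 1)) - ln (real 1)"
    using ek(2)[of 1] by simp
  \<comment> \<open>\<open>1 - exp (-1/N)\<close> is asymptotic to \<open>1 / N\<close>, so its
    logarithm cancels \<open>ln N\<close> in the limit.\<close>
  have "(\<lambda>N. harm N - ln (real N) + (ln (real N) + ln (1 - exp (- 1 / real N)))) \<longlonglongrightarrow> euler_mascheroni + 0"
    by (intro tendsto_add euler_mascheroni_LIMSEQ) real_asymp
  hence lim1: "(\<lambda>N. harm N + ln (1 - exp (- 1 / real N))) \<longlonglongrightarrow> (euler_mascheroni :: real)"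
    by simp
  have lim3: "(\<lambda>N. harm N + ln (1 - exp (- 1 / real N)) + 
      \<epsilon> * (\<Sum>n. 1 / real n * (u N n ^ 1 - u N n ^ Suc 1)) + 3 * \<epsilon>) \<longlonglongrightarrow> euler_mascheroni + \<epsilon> * ln 2 + 3 * \<epsilon>"
    by (rule tendsto_eq_intros lim1 lim2 refl | simp)+
  have "(\<Sum>j\<le>m. a j * (ln (real (Suc (Suc j))) - ln (real (Suc j)))) \<le> euler_mascheroni + \<epsilon> * ln 2 + 3 * \<epsilon>"
  proof (rule tendsto_le[OF _ lim3 K(2)])
    show "\<forall>\<^sub>F N in sequentially. (\<Sum>n. 1 / real n * ?q (u N n)) \<le> harm N + ln (1 - exp (- 1 / real N)) + 
      \<epsilon> * (\<Sum>n. 1 / real n * (u N n ^ 1 - u N n ^ Suc 1)) + 3 * \<epsilon>"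
      using K(1) ek(1)[of 1, OF order_refl] eventually_gt_at_top[of 0]
    proof eventually_elim
      case (elim N)
      \<comment> \<open>The indices whose point falls on the ramp. There are at most
        \<open>N * \<epsilon>\<close> of them, each contributing at most
        \<open>3 / N\<close>.\<close>
      let ?I = "{n. real N < real n \<and> real n < real N * (1 + \<epsilon>)}"
      have sub: "?I \<subseteq> {N<..nat \<lfloor>real N * (1 + \<epsilon>)\<rfloor>}" 
        by (auto simp: le_nat_floor)
      have fin: "finite ?I" by (rule finite_subset[OF sub]) auto
      have "card ?I \<le> nat \<lfloor>real N * (1 + \<epsilon>)\<rfloor> - N" using card_mono[OF _ sub] by simp
      also have "real (nat \<lfloor>real N * (1 + \<epsilon>)\<rfloor> - N) \<le> real N * \<epsilon>"
      proof -
        have "real (nat \<lfloor>real N * (1 + \<epsilon>)\<rfloor>) \<le> real N * (1 + \<epsilon>)" using e by (intro of_nat_floor) simp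
        thus ?thesis using e by (cases "nat \<lfloor>real N * (1 + \<epsilon>)\<rfloor> \<ge> N") (auto simp: of_nat_diff algebra_simps)
      qed
      finally have card: "real (card ?I) \<le> real N * \<epsilon>" by simp
      have "(\<Sum>n\<in>?I. 3 / real n) \<le> (\<Sum>n\<in>?I. 3 / real N)"
        using elim by (intro sum_mono) (auto simp: field_simps)
      also have "\<dots> \<le> 3 * \<epsilon>" using card elim by (simp add: field_simps)
      finally have I: "(\<Sum>n\<in>?I. 3 / real n) \<le> 3 * \<epsilon>" .
      have s: "(\<lambda>n. 1 / real n * cutoff (u N n) + \<epsilon> * (1 / real n * (u N n ^ 1 - u N n ^ Suc 1)) + 
            (if n \<in> ?I then 3 / real n else 0)) sums
          (harm N + ln (1 - exp (- 1 / real N)) + \<epsilon> * (\<Sum>n. 1 / real n * (u N n ^ 1 - u N n ^ Suc 1)) + (\<Sum>n\<in>?I. 3 / real n))"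
        using exp_weights_cutoff_sums[of N] elim unfolding u_def
        by (intro sums_add sums_mult summable_sums sums_If_finite_set fin) auto
      have "(\<Sum>n. 1 / real n * ?q (u N n)) \<le> 
          harm N + ln (1 - exp (- 1 / real N)) + \<epsilon> * (\<Sum>n. 1 / real n * (u N n ^ 1 - u N n ^ Suc 1)) + (\<Sum>n\<in>?I. 3 / real n)"
      proof (rule sums_le[OF _ summable_sums s])
        show "summable (\<lambda>n. 1 / real n * ?q (u N n))" using elim by simp
        fix n
        have "1 / real n * ?q (u N n) \<le> 1 / real n * (cutoff (u N n) + \<epsilon> * (u N n * (1 - u N n)) + 
           (if exp (-(1 + \<epsilon>)) < u N n \<and> u N n < exp (-1) then 3 else 0))"
          by (intro mult_left_mono up) (auto simp: u_def)
        also have "\<dots> = 1 / real n * cutoff (u N n) + \<epsilon> * (1 / real n * (u N n ^ 1 - u N n ^ Suc 1)) + 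
           1 / real n * (if exp (-(1 + \<epsilon>)) < u N n \<and> u N n < exp (-1) then 3 else 0)"
          by (simp add: algebra_simps)
        also have "exp (-(1 + \<epsilon>)) < u N n \<and> u N n < exp (-1) \<longleftrightarrow> n \<in> ?I"
          using elim by (auto simp: u_def field_simps)
        finally show "1 / real n * ?q (u N n) \<le> 1 / real n * cutoff (u N n) + \<epsilon> * (1 / real n * (u N n ^ 1 - u N n ^ Suc 1)) + 
            (if n \<in> ?I then 3 / real n else 0)" by (auto split: if_splits)
      qed
      thus ?case using I by linarith
    qed
  qed auto
  also have "\<epsilon> * ln 2 \<le> \<epsilon> * 1" using e ln_2_less_1 by (intro mult_left_mono) auto
  finally show ?thesis by simp
qed

section \<open>The upper bound in Mertens' third theorem\<close>

text \<open>The contribution of the prime powers with exponent at least 2 to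
  \<open>ln (zeta_real (1 + \<delta>))\<close>. Unlike the sum over the primes themselves, it still
  converges at \<open>\<delta> = 0\<close>.\<close>

definition prime_tail :: "real \<Rightarrow> real" where
  "prime_tail \<delta> = (\<Sum>p. if prime p then - ln (1 - real p powr -(1 + \<delta>)) - real p powr -(1 + \<delta>) else 0)"

lemma prime_tail_term_bounds:
  fixes p :: nat
  assumes "\<delta> \<ge> 0" "prime p"
  shows "0 \<le> - ln (1 - real p powr -(1 + \<delta>)) - real p powr -(1 + \<delta>)"
    and "- ln (1 - real p powr -(1 + \<delta>)) - real p powr -(1 + \<delta>) \<le> 2 * real p powr -2"
proof -
  define y where "y = real p powr -(1 + \<delta>)"
  have y: "0 \<le> y" "y \<le> 1 / 2" using prime_powr_le_half[of "1 + \<delta>" p] assms by (auto simp: y_def)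
  have "y\<^sup>2 = real p powr (-(2 + 2 * \<delta>))"
    by (simp add: y_def power2_eq_square powr_add[symmetric])
  also have "\<dots> \<le> real p powr -2"
    using assms prime_gt_0_nat[of p] by (intro powr_mono) auto
  finally have y2: "y\<^sup>2 \<le> real p powr -2" .
  have "ln (1 - y) \<le> - y" using ln_le_minus_one[of "1 - y"] y by simp
  moreover have "- y - 2 * y\<^sup>2 \<le> ln (1 - y)" by (rule ln_one_minus_pos_lower_bound) (use y in auto)
  ultimately show "0 \<le> - ln (1 - real p powr -(1 + \<delta>)) - real p powr -(1 + \<delta>)"
    "- ln (1 - real p powr -(1 + \<delta>)) - real p powr -(1 + \<delta>) \<le> 2 * real p powr -2"
    using y2 unfolding y_def by linarith+
qed

lemma prime_tail_summable:
  assumes "\<delta> \<ge> 0"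
  shows "summable (\<lambda>p. if prime p then - ln (1 - real p powr -(1 + \<delta>)) - real p powr -(1 + \<delta>) else 0)"
proof (rule summable_comparison_test)
  show "summable (\<lambda>p. 2 * real p powr -2)" by (intro summable_mult summable_powr_neg) auto
  show "\<exists>N. \<forall>p\<ge>N. norm (if prime p then - ln (1 - real p powr -(1 + \<delta>)) - real p powr -(1 + \<delta>) else 0) \<le> 2 * real p powr -2"
    using prime_tail_term_bounds[OF assms] by (intro exI[of _ 0] allI impI) (simp only: real_norm_def, simp)
qed

text \<open>Tannery's theorem: the terms are dominated by the summable \<open>2 * p powr -2\<close>,
  uniformly in \<open>\<delta> \<ge> 0\<close>.\<close>

lemma prime_tail_tendsto: "(prime_tail \<longlongrightarrow> prime_tail 0) (at_right 0)"
proof -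
  let ?g = "\<lambda>p \<delta>. if prime p then - ln (1 - real p powr -(1 + \<delta>)) - real p powr -(1 + \<delta>) else 0"
  have lim: "((\<lambda>\<delta>. ?g p \<delta>) \<longlongrightarrow> ?g p 0) (at_right 0)" for p
  proof (cases "prime p")
    case True
    have "real p powr -(1 + 0) \<le> 1/2" using prime_powr_le_half[of 1 p] True by simp
    thus ?thesis using True prime_gt_0_nat[of p] 
      by (auto intro!: tendsto_eq_intros)
  qed auto
  have bound: "eventually (\<lambda>(p, \<delta>). norm (?g p \<delta>) \<le> 2 * real p powr -2) (at_top \<times>\<^sub>F at_right 0)"
  proof -
    have "eventually (\<lambda>\<delta>::real. \<delta> \<ge> 0) (at_right 0)" by (auto simp: eventually_at_right_field intro!: exI[of _ 1])
    hence "eventually (\<lambda>z. snd z \<ge> 0) ((at_top :: nat filter) \<times>\<^sub>F at_right (0::real))"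
      by (rule eventually_compose_filterlim[OF _ filterlim_snd])
    thus ?thesis
    proof eventually_elim
      case (elim z)
      thus ?case using prime_tail_term_bounds[of "snd z" "fst z"]
        by (cases z) (simp only: real_norm_def, simp)
    qed
  qed
  have "summable (\<lambda>p. 2 * real p powr -2)" by (intro summable_mult summable_powr_neg) auto
  from tannerys_theorem[OF lim bound this] show ?thesis unfolding prime_tail_def by auto
qed

lemma prime_powr_sums:
  assumes "\<delta> > 0"
  shows "(\<lambda>p. if prime p then real p powr -(1 + \<delta>) else 0) sums (ln (zeta_real (1 + \<delta>)) - prime_tail \<delta>)"
proof -
  have "(\<lambda>p. (if prime p then - ln (1 - real p powr -(1 + \<delta>)) else 0) -
      (if prime p then - ln (1 - real p powr -(1 + \<delta>)) - real p powr -(1 + \<delta>) else 0))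
      sums (ln (zeta_real (1 + \<delta>)) - prime_tail \<delta>)"
    unfolding prime_tail_def using assms
    by (intro sums_diff euler_product_ln summable_sums prime_tail_summable) auto
  thus ?thesis by (rule sums_cong[THEN iffD1, rotated]) auto
qed

section \<open>The weights \<open>1 / p\<close> at the points
  \<open>p powr -\<delta>\<close>\<close>

abbreviation prime_weight :: "nat \<Rightarrow> real" where
  "prime_weight p \<equiv> (if prime p then 1 / real p else 0)"

text \<open>Taking the \<open>k\<close>-th power of \<open>p powr -\<delta>\<close> merely replaces
  \<open>\<delta>\<close> by \<open>k * \<delta>\<close>.\<close>

lemma prime_weights_sums:
  assumes "\<delta> > 0" "k > 0"
  shows "(\<lambda>p. prime_weight p * (real p powr -\<delta>) ^ k) sums
           (ln (zeta_real (1 + real k * \<delta>)) - prime_tail (real k * \<delta>))"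
proof -
  have "prime_weight p * (real p powr -\<delta>) ^ k = (if prime p then real p powr -(1 + real k * \<delta>) else 0)" for p
  proof (cases "prime p")
    case True
    hence p: "p > 0" by (rule prime_gt_0_nat)
    have "(real p powr -\<delta>) ^ k = real p powr - (real k * \<delta>)"
      using p by (simp add: powr_realpow[symmetric] powr_powr mult.commute)
    moreover have "real p powr -(1 + real k * \<delta>) = real p powr (-1 + -(real k * \<delta>))" by simp
    hence "real p powr -(1 + real k * \<delta>) = real p powr -1 * real p powr -(real k * \<delta>)"
      by (simp only: powr_add)
    moreover have "real p powr -1 = 1 / real p" using p by (simp add: powr_minus inverse_eq_divide)
    ultimately show ?thesis using True by simp
  qed auto
  thus ?thesis using prime_powr_sums[of "real k * \<delta>"] assms by simp
qed

text \<open>The factor \<open>k * \<delta>\<close> cancels the pole of zeta at 1, so the logarithm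
  tends to 0.\<close>

lemma ln_zeta_prime_tail_diff_tendsto:
  fixes k :: nat
  assumes "k > 0"
  shows "((\<lambda>\<delta>. ln (real k * \<delta> * zeta_real (1 + real k * \<delta>)) - prime_tail (real k * \<delta>)) \<longlongrightarrow> - prime_tail 0) (at_right 0)"
proof -
  have f: "filterlim (\<lambda>\<delta>. real k * \<delta>) (at_right 0) (at_right 0)"
    using assms by real_asymp
  have 1: "((\<lambda>\<delta>. real k * \<delta> * zeta_real (1 + real k * \<delta>)) \<longlongrightarrow> 1) (at_right 0)"
    using filterlim_compose[OF zeta_times_tendsto f] by simp
  have 2: "((\<lambda>\<delta>. prime_tail (real k * \<delta>)) \<longlongrightarrow> prime_tail 0) (at_right 0)"
    using filterlim_compose[OF prime_tail_tendsto f] by simp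
  show ?thesis by (rule tendsto_eq_intros 1 2 refl | simp)+
qed

text \<open>With the pole split off as \<open>- ln (k * \<delta>)\<close>, the remaining parts
  \<open>?F k\<close> and \<open>?F (Suc k)\<close> have the same limit. Only the difference of the
  logarithms of \<open>Suc k\<close> and \<open>k\<close> survives, exactly as for the comparison
  weights.\<close>

lemma prime_weights_karamata:
  assumes "k \<ge> 1"
  shows "\<forall>\<^sub>F \<delta> in at_right 0. summable (\<lambda>p. prime_weight p * ((real p powr -\<delta>) ^ k - (real p powr -\<delta>) ^ Suc k))"
    and "((\<lambda>\<delta>. \<Sum>p. prime_weight p * ((real p powr -\<delta>) ^ k - (real p powr -\<delta>) ^ Suc k))
       \<longlongrightarrow> ln (real (Suc k)) - ln (real k)) (at_right 0)"
proof -
  let ?F = "\<lambda>k \<delta>. ln (real k * \<delta> * zeta_real (1 + real k * \<delta>)) - prime_tail (real k * \<delta>)"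
  have pos: "\<forall>\<^sub>F \<delta>::real in at_right 0. \<delta> > 0" by (auto simp: eventually_at_right_field intro!: exI[of _ 1])
  hence ev: "\<forall>\<^sub>F \<delta> in at_right 0. (\<lambda>p. prime_weight p * ((real p powr -\<delta>) ^ k - (real p powr -\<delta>) ^ Suc k)) sums
     (?F k \<delta> - ?F (Suc k) \<delta> + (ln (real (Suc k)) - ln (real k)))"
  proof eventually_elim
    case (elim \<delta>)
    have z: "zeta_real (1 + real j * \<delta>) > 0" if "j > 0" for j
      using zeta_real_pos[of "real j * \<delta>"] elim that by simp
    have ln: "ln (real j * \<delta> * zeta_real (1 + real j * \<delta>)) = ln (real j) + ln \<delta> + ln (zeta_real (1 + real j * \<delta>))"
      if "j > 0" for j using z[OF that] elim that by (simp add: ln_mult_pos)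
    have "(\<lambda>p. prime_weight p * ((real p powr -\<delta>) ^ k - (real p powr -\<delta>) ^ Suc k)) sums
      (ln (zeta_real (1 + real k * \<delta>)) - prime_tail (real k * \<delta>) - 
       (ln (zeta_real (1 + real (Suc k) * \<delta>)) - prime_tail (real (Suc k) * \<delta>)))"
      unfolding right_diff_distrib by (intro sums_diff prime_weights_sums) (use elim assms in auto)
    moreover have "ln (zeta_real (1 + real k * \<delta>)) - prime_tail (real k * \<delta>) - 
       (ln (zeta_real (1 + real (Suc k) * \<delta>)) - prime_tail (real (Suc k) * \<delta>)) =
       ?F k \<delta> - ?F (Suc k) \<delta> + (ln (real (Suc k)) - ln (real k))"
      using ln[of k] ln[of "Suc k"] assms by (simp del: of_nat_Suc)
    ultimately show ?case by (simp only:)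
  qed
  thus "\<forall>\<^sub>F \<delta> in at_right 0. summable (\<lambda>p. prime_weight p * ((real p powr -\<delta>) ^ k - (real p powr -\<delta>) ^ Suc k))"
    by eventually_elim (auto simp: sums_iff)
  have "((\<lambda>\<delta>. ?F k \<delta> - ?F (Suc k) \<delta> + (ln (real (Suc k)) - ln (real k))) \<longlongrightarrow>
      - prime_tail 0 - - prime_tail 0 + (ln (real (Suc k)) - ln (real k))) (at_right 0)"
    by (intro tendsto_add tendsto_diff tendsto_const ln_zeta_prime_tail_diff_tendsto) (use assms in auto)
  hence "((\<lambda>\<delta>. ?F k \<delta> - ?F (Suc k) \<delta> + (ln (real (Suc k)) - ln (real k))) \<longlongrightarrow>
      (ln (real (Suc k)) - ln (real k))) (at_right 0)" by simp
  thus "((\<lambda>\<delta>. \<Sum>p. prime_weight p * ((real p powr -\<delta>) ^ k - (real p powr -\<delta>) ^ Suc k))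
       \<longlongrightarrow> ln (real (Suc k)) - ln (real k)) (at_right 0)"
    by (rule Lim_transform_eventually) (use ev in eventually_elim, auto simp: sums_iff)
qed

lemma finite_primes_le: "finite {p::nat. prime p \<and> real p \<le> x}"
  by (rule finite_subset[of _ "{..nat \<lfloor>x\<rfloor>}"]) (auto simp: le_nat_floor)

lemma prime_cutoff_sums:
  assumes "x > 1"
  shows "(\<lambda>p. prime_weight p * cutoff (real p powr -(1 / ln x))) sums
    ((\<Sum>p | prime p \<and> real p \<le> x. 1 / real p) - (ln (zeta_real (1 + 1 / ln x)) - prime_tail (1 / ln x)))"
proof -
  let ?A = "{p. prime p \<and> real p \<le> x}"
  have d: "1 / ln x > 0" using assms by simp
  have 1: "(\<lambda>p. if p \<in> ?A then 1 / real p else 0) sums (\<Sum>p\<in>?A. 1 / real p)"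
    by (rule sums_If_finite_set[OF finite_primes_le])
  have 2: "(\<lambda>p. prime_weight p * (real p powr -(1 / ln x))) sums (ln (zeta_real (1 + 1 / ln x)) - prime_tail (1 / ln x))"
    using prime_weights_sums[OF d, of 1] by simp
  have "(if p \<in> ?A then 1 / real p else 0) - prime_weight p * (real p powr -(1 / ln x)) =
      prime_weight p * cutoff (real p powr -(1 / ln x))" for p
  proof (cases "prime p")
    case True
    hence p: "p > 0" by (rule prime_gt_0_nat)
    have "exp (- 1) \<le> real p powr -(1 / ln x) \<longleftrightarrow> real p \<le> x"
      using p assms by (simp add: powr_def field_simps)
    thus ?thesis using True by (simp add: cutoff_def field_simps)
  qed auto
  thus ?thesis using sums_diff[OF 1 2] by simp
qed

text \<open>The cutoff sum is the sum of \<open>1 / p\<close> over \<open>p \<le> x\<close> minus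
  that of \<open>p powr -(1 + 1 / ln x)\<close> over all primes. The polynomial majorant bounds it
  by \<open>T + \<eta>\<close>, and the Euler product evaluates the second sum. Replacing
  \<open>1 / p\<close> by \<open>- ln (1 - 1 / p)\<close> costs at most \<open>prime_tail 0\<close>,
  which cancels the limit of \<open>prime_tail (1 / ln x)\<close>.\<close>

lemma mertens_upper:
  assumes e: "\<epsilon> > 0"
  shows "\<forall>\<^sub>F x in at_top. (\<Sum>p | prime p \<and> real p \<le> x. - ln (1 - 1 / real p)) \<le> ln (ln x) + euler_mascheroni + \<epsilon>"
proof -
  \<comment> \<open>The losses add up to \<open>6 * \<eta>\<close>: \<open>4 * \<eta>\<close> in
    \<open>T\<close> and \<open>\<eta>\<close> for each of the two limits.\<close>
  define \<eta> where "\<eta> = min 1 (\<epsilon> / 8)"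
  have \<eta>: "0 < \<eta>" "\<eta> \<le> 1" "8 * \<eta> \<le> \<epsilon>" using e by (auto simp: \<eta>_def)
  obtain a :: "nat \<Rightarrow> real" and m where am:
    "\<And>u. 0 \<le> u \<Longrightarrow> u \<le> 1 \<Longrightarrow> cutoff u \<le> u * (1 - u) * (\<Sum>j\<le>m. a j * u ^ j)"
    "\<And>u. 0 \<le> u \<Longrightarrow> u \<le> 1 \<Longrightarrow> u * (1 - u) * (\<Sum>j\<le>m. a j * u ^ j) \<le>
       cutoff u + \<eta> * (u * (1 - u)) + (if exp (-(1 + \<eta>)) < u \<and> u < exp (-1) then 3 else 0)"
    using cutoff_polynomial_majorant[OF \<eta>(1,2)] by blast
  let ?q = "\<lambda>u. u * (1 - u) * (\<Sum>j\<le>m. a j * u ^ j)"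
  define T where "T = (\<Sum>j\<le>m. a j * (ln (real (Suc (Suc j))) - ln (real (Suc j))))"
  have T: "T \<le> euler_mascheroni + 4 * \<eta>"
    unfolding T_def by (rule karamata_limit_le[OF \<eta>(1) am(2)])
  have K: "\<forall>\<^sub>F \<delta> in at_right 0. summable (\<lambda>p. prime_weight p * ?q (real p powr -\<delta>))"
     "((\<lambda>\<delta>. \<Sum>p. prime_weight p * ?q (real p powr -\<delta>)) \<longlongrightarrow> T) (at_right 0)"
    unfolding T_def
    by (rule karamata_polynomial[where w = "\<lambda>_ p. prime_weight p" and u = "\<lambda>\<delta> p. real p powr -\<delta>"];
        use prime_weights_karamata in blast)+
  have f: "filterlim (\<lambda>x. 1 / ln x) (at_right 0) (at_top :: real filter)" by real_asymp
  have "\<forall>\<^sub>F \<delta> in at_right 0. (\<Sum>p. prime_weight p * ?q (real p powr -\<delta>)) < T + \<eta>"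
    using K(2) \<eta> by (intro order_tendstoD) auto
  moreover have "\<forall>\<^sub>F \<delta> in at_right 0. ln (1 * \<delta> * zeta_real (1 + 1 * \<delta>)) - prime_tail (1 * \<delta>) < - prime_tail 0 + \<eta>"
    using ln_zeta_prime_tail_diff_tendsto[of 1] \<eta> by (intro order_tendstoD) auto
  ultimately have "\<forall>\<^sub>F \<delta> in at_right 0. summable (\<lambda>p. prime_weight p * ?q (real p powr -\<delta>)) \<and>
     (\<Sum>p. prime_weight p * ?q (real p powr -\<delta>)) < T + \<eta> \<and>
     ln (\<delta> * zeta_real (1 + \<delta>)) - prime_tail \<delta> < - prime_tail 0 + \<eta>"
    using K(1) by eventually_elim auto
  from eventually_compose_filterlim[OF this f] eventually_gt_at_top[of 1]
  show ?thesis
  proof eventually_elim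
    case (elim x)
    let ?d = "1 / ln x" and ?A = "{p. prime p \<and> real p \<le> x}"
    have d: "?d > 0" using elim by simp
    have le1: "real p powr - ?d \<le> 1" for p
    proof (cases "p = 0")
      case False
      hence "real p powr - ?d \<le> real p powr 0" using d by (intro powr_mono) auto
      thus ?thesis using False by simp
    qed auto
    have "(\<Sum>p\<in>?A. 1 / real p) - (ln (zeta_real (1 + ?d)) - prime_tail ?d) \<le> (\<Sum>p. prime_weight p * ?q (real p powr -?d))"
      by (rule sums_le[OF _ prime_cutoff_sums summable_sums])
         (use elim le1 am(1) in \<open>auto intro!: mult_left_mono divide_right_mono\<close>)
    hence 1: "(\<Sum>p\<in>?A. 1 / real p) \<le> ln (zeta_real (1 + ?d)) - prime_tail ?d + T + \<eta>" using elim by linarith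
    have 2: "(\<Sum>p\<in>?A. - ln (1 - 1 / real p) - 1 / real p) \<le> prime_tail 0"
    proof -
      let ?t = "\<lambda>p::nat. if prime p then - ln (1 - real p powr -(1 + 0)) - real p powr -(1 + 0) else 0"
      have "(\<Sum>p\<in>?A. - ln (1 - 1 / real p) - 1 / real p) = sum ?t ?A"
        by (intro sum.cong) (auto simp: powr_minus inverse_eq_divide)
      also have "\<dots> \<le> suminf ?t"
        using prime_tail_term_bounds(1)[of 0] by (intro sum_le_suminf prime_tail_summable finite_primes_le) auto
      finally show ?thesis by (simp add: prime_tail_def)
    qed
    have "ln (?d * zeta_real (1 + ?d)) = - ln (ln x) + ln (zeta_real (1 + ?d))"
      using zeta_real_pos[OF d] elim by (simp add: ln_mult_pos ln_div)
    hence "ln (zeta_real (1 + ?d)) - prime_tail ?d < ln (ln x) - prime_tail 0 + \<eta>"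
      using elim by linarith
    with 1 2 T \<eta> show ?case by (simp add: sum_subtractf)
  qed
qed

section \<open>Prefixes of formal prime products\<close>

text \<open>
  A function \<open>\<omega>\<close> of exponents stands for the formal product of all \<open>p ^ \<omega> p\<close>;
  the prefixes of \<open>\<omega>\<close> are the products of its first finitely many prime factors in increasing order.
\<close>

definition is_prefix :: "(nat \<Rightarrow> nat) \<Rightarrow> nat \<Rightarrow> bool" where
  "is_prefix \<omega> a \<longleftrightarrow> a > 1 \<and> (\<forall>p. prime p \<and> p < P a \<longrightarrow> \<omega> p = multiplicity p a) \<and>
     multiplicity (P a) a \<le> \<omega> (P a)"

lemma P_largest_prime:
  assumes "a > 1"
  shows "prime (P a)" "P a dvd a" "\<And>q. prime q \<Longrightarrow> q dvd a \<Longrightarrow> q \<le> P a"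
proof -
  have "prime_factors a \<noteq> {}" using assms by (auto simp: prime_factorization_empty_iff)
  hence "P a \<in> prime_factors a" unfolding P_def by (intro Max_in) auto
  thus "prime (P a)" "P a dvd a" by auto
  show "q \<le> P a" if "prime q" "q dvd a" for q
    unfolding P_def using that assms by (intro Max_ge) (auto simp: prime_factors_dvd)
qed

lemma P_le: "a > 1 \<Longrightarrow> P a \<le> a"
  using P_largest_prime(2)[of a] by (auto intro: dvd_imp_le)

lemma multiplicity_above_P:
  assumes "a > 1" "prime q" "q > P a"
  shows "multiplicity q a = 0"
  using P_largest_prime(3)[of a q] assms by (intro not_dvd_imp_multiplicity_0) auto

lemma is_prefix_multiplicity_below:
  assumes "is_prefix \<omega> a" "is_prefix \<omega> b" "P a \<le> P b" "prime p" "p < P a"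
  shows "multiplicity p a = multiplicity p b"
  using assms unfolding is_prefix_def by (metis order_less_le_trans)

text \<open>Prefixes of one \<open>\<omega>\<close> are ordered by their largest prime and then by
  its multiplicity: the exponents below \<open>P a\<close> are dictated by \<open>\<omega>\<close>,
  and above \<open>P a\<close> there are none.\<close>

lemma is_prefix_dvd:
  assumes a: "is_prefix \<omega> a" and b: "is_prefix \<omega> b"
    and le: "P a < P b \<or> P a = P b \<and> multiplicity (P a) a \<le> multiplicity (P a) b"
  shows "a dvd b"
proof (rule multiplicity_le_imp_dvd)
  show "a \<noteq> 0" using a by (simp add: is_prefix_def)
  fix p :: nat assume p: "prime p"
  consider "p < P a" | "p = P a" | "p > P a" by linarith
  thus "multiplicity p a \<le> multiplicity p b"
  proof cases
    case 1
    thus ?thesis using is_prefix_multiplicity_below[OF a b _ p] le by auto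
  next
    case 2
    thus ?thesis using a b le p unfolding is_prefix_def by auto
  next
    case 3
    thus ?thesis using multiplicity_above_P[of a p] a p by (simp add: is_prefix_def)
  qed
qed

text \<open>The smaller prefix divides the larger, and a prime below \<open>P a\<close> has the same
  multiplicity in both, so it cannot divide the cofactor.\<close>

lemma is_prefix_less_imp_L:
  assumes a: "is_prefix \<omega> a" and b: "is_prefix \<omega> b" and less: "a < b"
  shows "b \<in> L a"
proof -
  have pos: "a > 1" "b > 1" using a b by (auto simp: is_prefix_def)
  have "\<not> b dvd a" using less pos by (auto dest: dvd_imp_le)
  hence le: "P a < P b \<or> P a = P b \<and> multiplicity (P a) a \<le> multiplicity (P a) b"
    using is_prefix_dvd[OF b a] by (metis nat_le_linear linorder_neqE_nat)
  obtain c where c: "b = a * c" using is_prefix_dvd[OF a b le] by (auto elim: dvdE)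
  have "c \<ge> 1" using c pos by (cases c) auto
  moreover have "P a \<le> p" if p: "prime p" "p dvd c" for p
  proof (rule ccontr)
    assume "\<not> P a \<le> p"
    hence "multiplicity p a = multiplicity p b"
      using le p by (intro is_prefix_multiplicity_below[OF a b]) auto
    also have "\<dots> = multiplicity p a + multiplicity p c"
      unfolding c using p pos \<open>c \<ge> 1\<close> by (intro prime_elem_multiplicity_mult_distrib) auto
    finally have "multiplicity p c = 0" by simp
    moreover have "multiplicity p c > 0"
      using p \<open>c \<ge> 1\<close> by (simp add: prime_multiplicity_gt_zero_iff)
    ultimately show False by simp
  qed
  ultimately show ?thesis unfolding L_def using c by (auto simp: mult.commute)
qed

text \<open>A prefix is determined by its largest prime \<open>p\<close> and the multiplicity of
  \<open>p\<close>, which lies between 1 and \<open>\<omega> p\<close>. This reduces the second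
  moment of the chain count to that of a sum of independent variables.\<close>

lemma card_prefixes_le:
  assumes "\<And>a. a \<in> B \<Longrightarrow> is_prefix \<omega> a \<and> real a \<le> x"
  shows "card B \<le> (\<Sum>p | prime p \<and> real p \<le> x. \<omega> p)"
proof -
  let ?F = "{p. prime p \<and> real p \<le> x}"
  let ?f = "\<lambda>a. (P a, multiplicity (P a) a)"
  have inj: "inj_on ?f B"
  proof (rule inj_onI)
    fix a b assume ab: "a \<in> B" "b \<in> B" "?f a = ?f b"
    hence "a dvd b" "b dvd a" using assms by (auto intro!: is_prefix_dvd[of \<omega>])
    thus "a = b" by (rule dvd_antisym)
  qed
  have "?f ` B \<subseteq> Sigma ?F (\<lambda>p. {1..\<omega> p})"
  proof safe
    fix a assume "a \<in> B"
    hence a: "a > 1" "is_prefix \<omega> a" "real a \<le> x" using assms by (auto simp: is_prefix_def)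
    show "prime (P a)" by (rule P_largest_prime[OF a(1)])
    show "real (P a) \<le> x" using P_le[OF a(1)] a by linarith
    have "multiplicity (P a) a > 0" using P_largest_prime[OF a(1)] a
      by (simp add: prime_multiplicity_gt_zero_iff)
    thus "multiplicity (P a) a \<in> {1..\<omega> (P a)}" using a(2) by (auto simp: is_prefix_def)
  qed
  hence "card (?f ` B) \<le> card (Sigma ?F (\<lambda>p. {1..\<omega> p}))"
    by (rule card_mono[rotated]) (auto intro: finite_primes_le)
  thus ?thesis using inj finite_primes_le by (simp add: card_image)
qed

section \<open>Random exponents\<close>

lemma prob_geometric_atLeast:
  assumes "0 < r" "r < 1"
  shows "measure (measure_pmf (geometric_pmf (1 - r))) {k..} = r ^ k"
proof -
  have "measure (measure_pmf (geometric_pmf (1 - r))) (UNIV - {..<k}) = 1 - (\<Sum>i<k. r ^ i * (1 - r))"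
    using measure_pmf.prob_compl[of "{..<k}" "geometric_pmf (1 - r)"] assms
    by (simp add: measure_measure_pmf_finite)
  also have "\<dots> = r ^ k" using one_diff_power_eq[of r k] by (simp add: sum_distrib_left mult.commute)
  also have "UNIV - {..<k} = {k..}" by auto
  finally show ?thesis .
qed

text \<open>A majorant of the square with an explicit geometric expectation. It vanishes at
  \<open>n = 0\<close>, which makes that expectation of order \<open>r\<close>, and the base
  \<open>3/2\<close> keeps the series convergent for \<open>r \<le> 1/2\<close>.\<close>

lemma square_le_exp_growth: "(real n)\<^sup>2 \<le> 4 * (3/2) ^ n - 4"
proof -
  have large: "(real n)\<^sup>2 + 4 \<le> 4 * (3/2) ^ n" if "n \<ge> 4" for n
    using that
  proof (induction n rule: dec_induct)
    case (step n)
    have "4 * real n \<le> real n * real n" using step by (intro mult_right_mono) auto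
    hence "real n * real n + 2 * real n + 5 \<le> 3/2 * (real n * real n + 4)"
      by (simp add: field_simps)
    also have "real n * real n + 2 * real n + 5 = (real (Suc n))\<^sup>2 + 4"
      by (simp add: power2_eq_square algebra_simps)
    finally have "(real (Suc n))\<^sup>2 + 4 \<le> 3/2 * ((real n)\<^sup>2 + 4)" by (simp add: power2_eq_square)
    thus ?case using step by simp
  qed (simp add: power_def)
  consider "n \<ge> 4" | "n = 0" | "n = 1" | "n = 2" | "n = 3" by linarith
  thus ?thesis
  proof cases
    case 1
    thus ?thesis using large[of n] by simp
  qed (simp_all add: power2_eq_square power3_eq_cube)
qed

text \<open>The majorant has expectation \<open>2 * r / (1 - 3/2 * r)\<close>, with denominator at
  least \<open>1/4\<close>. Linearity in \<open>r = 1 / p\<close> keeps the sum over primes of order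
  \<open>ln (ln x)\<close>.\<close>

lemma geometric_second_moment:
  assumes r: "0 < r" "r \<le> 1 / 2"
  shows "integrable (measure_pmf (geometric_pmf (1 - r))) (\<lambda>n. (real n)\<^sup>2)"
    and "(\<integral>n. (real n)\<^sup>2 \<partial>measure_pmf (geometric_pmf (1 - r))) \<le> 8 * r"
proof -
  let ?G = "measure_pmf (geometric_pmf (1 - r))"
  have "(\<lambda>n. (3/2 * r) ^ n * (1 - r)) sums (1 / (1 - 3/2 * r) * (1 - r))"
    by (intro sums_mult2 geometric_sums) (use r in auto)
  hence s: "(\<lambda>n. (3/2) ^ n * (r ^ n * (1 - r))) sums ((1 - r) / (1 - 3/2 * r))"
    unfolding power_mult_distrib by (simp only: mult_ac times_divide_eq_left times_divide_eq_right mult_1)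
  have "(\<integral>\<^sup>+n. ennreal ((3/2) ^ n) \<partial>?G) = (\<Sum>n. ennreal ((3/2) ^ n * (r ^ n * (1 - r))))"
    using r by (simp add: nn_integral_measure_pmf nn_integral_count_space_nat ennreal_mult mult.commute)
  also have "\<dots> = ennreal ((1 - r) / (1 - 3/2 * r))"
    using s r by (intro suminf_ennreal_eq) auto
  finally have "has_bochner_integral ?G (\<lambda>n. (3/2) ^ n) ((1 - r) / (1 - 3/2 * r))"
    using r by (intro has_bochner_integral_nn_integral) auto
  hence i: "integrable ?G (\<lambda>n. (3/2 :: real) ^ n)" "(\<integral>n. (3/2 :: real) ^ n \<partial>?G) = (1 - r) / (1 - 3/2 * r)"
    by (auto simp: has_bochner_integral_iff)
  hence i2: "integrable ?G (\<lambda>n. 4 * (3/2 :: real) ^ n - 4)" by simp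
  show i3: "integrable ?G (\<lambda>n. (real n)\<^sup>2)"
    using square_le_exp_growth by (intro Bochner_Integration.integrable_bound[OF i2]) (auto intro: order_trans)
  have "(\<integral>n. (real n)\<^sup>2 \<partial>?G) \<le> (\<integral>n. 4 * (3/2) ^ n - 4 \<partial>?G)"
    by (intro integral_mono i2 i3 square_le_exp_growth)
  also have "\<dots> = 4 * ((1 - r) / (1 - 3/2 * r)) - 4" using i by simp
  also have "\<dots> \<le> 8 * r" 
  proof -
    have "0 \<le> r * (1 / 2 - r)" using r by simp
    hence "4 * (1 - r) \<le> (8 * r + 4) * (1 - 3/2 * r)" by (simp add: algebra_simps)
    thus ?thesis using r by (simp add: field_simps)
  qed
  finally show "(\<integral>n. (real n)\<^sup>2 \<partial>?G) \<le> 8 * r" .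
qed

text \<open>
  The exponent of \<open>p\<close> is at least \<open>k\<close> with probability \<open>p ^ -k\<close>, as for the \<open>p\<close>-adic
  valuation of a random integer.
\<close>

definition exponent_measure :: "nat \<Rightarrow> nat measure" where
  "exponent_measure p = measure_pmf (geometric_pmf (1 - 1 / real p))"

definition exponents :: "(nat \<Rightarrow> nat) measure" where
  "exponents = PiM {p. prime p} exponent_measure"

interpretation exponents: product_prob_space exponent_measure "{p. prime p}"
  rewrites "PiM {p. prime p} exponent_measure = exponents"
proof -
  interpret p: prob_space "exponent_measure p" for p
    unfolding exponent_measure_def by (rule prob_space_measure_pmf)
  show "product_prob_space exponent_measure" by unfold_locales
qed (simp add: exponents_def)

lemma sets_exponent_measure [simp]: "sets (exponent_measure p) = UNIV"
  and space_exponent_measure [simp]: "space (exponent_measure p) = UNIV"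
  by (auto simp: exponent_measure_def)

lemma measurable_exponent: "prime p \<Longrightarrow> (\<lambda>\<omega>. \<omega> p) \<in> measurable exponents (exponent_measure p)"
  unfolding exponents_def by (rule measurable_component_singleton) auto

definition prefix_event :: "nat \<Rightarrow> (nat \<Rightarrow> nat) set" where
  "prefix_event a = {\<omega>\<in>space exponents. is_prefix \<omega> a}"

text \<open>The event is a cylinder over the primes up to \<open>P a\<close>. An exact exponent
  \<open>k\<close> has probability \<open>p ^ -k * (1 - 1 / p)\<close>, a lower bound
  \<open>k\<close> has \<open>p ^ -k\<close>, and the powers multiply to
  \<open>1 / a\<close>.\<close>

lemma
  assumes a: "a > 1"
  shows sets_prefix_event: "prefix_event a \<in> sets exponents"
    and prob_prefix_event:
      "measure exponents (prefix_event a) = 1 / real a * (\<Prod>p | prime p \<and> p < P a. 1 - 1 / real p)"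
proof -
  let ?J = "{p. prime p \<and> p \<le> P a}"
  \<comment> \<open>At \<open>P a\<close> only a lower bound is imposed, since a prefix may stop
    inside a prime power.\<close>
  define X where "X = (\<lambda>p. if p < P a then {multiplicity p a} else {multiplicity p a..})"
  have J: "?J \<subseteq> {p. prime p}" "finite ?J" by auto
  note Pa = P_largest_prime[OF a]
  have eq: "prefix_event a = prod_emb {p. prime p} exponent_measure ?J (Pi\<^sub>E ?J X)"
  proof -
    have "is_prefix \<omega> a \<longleftrightarrow> (\<forall>p\<in>?J. \<omega> p \<in> X p)" for \<omega>
      using a Pa(1) unfolding is_prefix_def X_def by (auto simp: le_less)
    thus ?thesis
      unfolding prefix_event_def prod_emb_def exponents_def by (auto simp: space_PiM PiE_iff Pi_iff extensional_def)
  qed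
  show "prefix_event a \<in> sets exponents"
    unfolding eq exponents_def by (intro measurable_prod_emb sets_PiM_I_finite) auto
  have prob: "measure (exponent_measure p) (X p) = (1 / real p) ^ multiplicity p a * (if p < P a then 1 - 1 / real p else 1)"
    if "p \<in> ?J" for p
  proof -
    have "real p \<ge> 2" using that prime_ge_2_nat[of p] by auto
    hence "0 < 1 / real p" "1 / real p < 1" by auto
    thus ?thesis using prob_geometric_atLeast[of "1 / real p"]
      by (auto simp: X_def exponent_measure_def measure_pmf_single)
  qed
  have "measure exponents (prefix_event a) = (\<Prod>p\<in>?J. measure (exponent_measure p) (X p))"
    unfolding eq by (rule exponents.measure_PiM_emb[OF J]) auto
  also have "\<dots> = (\<Prod>p\<in>?J. (1 / real p) ^ multiplicity p a) * (\<Prod>p\<in>?J. if p < P a then 1 - 1 / real p else 1)"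
    by (simp add: prob prod.distrib)
  also have "(\<Prod>p\<in>?J. if p < P a then 1 - 1 / real p else 1) = (\<Prod>p | prime p \<and> p < P a. 1 - 1 / real p)"
    by (rule prod.mono_neutral_cong_right) auto
  also have "(\<Prod>p\<in>?J. (1 / real p) ^ multiplicity p a) = (\<Prod>p\<in>prime_factors a. (1 / real p) ^ multiplicity p a)"
    using Pa(3) a by (intro prod.mono_neutral_right) (auto simp: prime_factors_dvd not_dvd_imp_multiplicity_0)
  also have "\<dots> = 1 / (\<Prod>p\<in>prime_factors a. real p ^ multiplicity p a)"
    by (simp add: power_divide prod_dividef)
  also have "(\<Prod>p\<in>prime_factors a. real p ^ multiplicity p a) = real (\<Prod>p\<in>prime_factors a. p ^ multiplicity p a)"
    by simp
  also have "(\<Prod>p\<in>prime_factors a. p ^ multiplicity p a) = a"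
    using prime_factorization_nat[of a] a by simp
  finally show "measure exponents (prefix_event a) = 1 / real a * (\<Prod>p | prime p \<and> p < P a. 1 - 1 / real p)" .
qed

section \<open>Independence and moments of the exponents\<close>

lemma indep_vars_exponents:
  "exponents.indep_vars exponent_measure (\<lambda>p \<omega>. \<omega> p) {p. prime p}"
proof (subst exponents.indep_vars_iff_distr_eq_PiM')
  show "{p::nat. prime p} \<noteq> {}" using two_is_prime_nat by blast
  show "(\<lambda>\<omega>. \<omega> p) \<in> measurable exponents (exponent_measure p)" if "p \<in> {p. prime p}" for p
    using that by (intro measurable_exponent) auto
  have "distr exponents (PiM {p. prime p} exponent_measure) (\<lambda>\<omega>. \<lambda>p\<in>{p. prime p}. \<omega> p) = 
      distr exponents exponents (\<lambda>\<omega>. \<omega>)"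
    unfolding exponents_def by (intro distr_cong) (auto simp: space_PiM PiE_restrict)
  also have "\<dots> = PiM {p. prime p} exponent_measure" by (simp add: exponents_def)
  also have "\<dots> = PiM {p. prime p} (\<lambda>p. distr exponents (exponent_measure p) (\<lambda>\<omega>. \<omega> p))"
    by (intro PiM_cong refl) (use exponents.PiM_component in auto)
  finally show "distr exponents (PiM {p. prime p} exponent_measure) (\<lambda>\<omega>. \<lambda>p\<in>{p. prime p}. \<omega> p) = 
     PiM {p. prime p} (\<lambda>p. distr exponents (exponent_measure p) (\<lambda>\<omega>. \<omega> p))" .
qed

lemma exponent_second_moment:
  assumes p: "prime p"
  shows "integrable exponents (\<lambda>\<omega>. (real (\<omega> p))\<^sup>2)"
    and "(\<integral>\<omega>. (real (\<omega> p))\<^sup>2 \<partial>exponents) \<le> 8 / real p"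
proof -
  have r: "0 < 1 / real p" "1 / real p \<le> 1 / 2" using prime_ge_2_nat[OF p] by auto
  have d: "distr exponents (exponent_measure p) (\<lambda>\<omega>. \<omega> p) = exponent_measure p"
    using exponents.PiM_component[of p] p by simp
  note m = measurable_exponent[OF p]
  have f: "(\<lambda>n::nat. (real n)\<^sup>2) \<in> borel_measurable (exponent_measure p)"
    by (simp add: exponent_measure_def)
  show "integrable exponents (\<lambda>\<omega>. (real (\<omega> p))\<^sup>2)"
    using integrable_distr_eq[OF m f] geometric_second_moment(1)[OF r] unfolding d
    by (simp add: exponent_measure_def)
  show "(\<integral>\<omega>. (real (\<omega> p))\<^sup>2 \<partial>exponents) \<le> 8 / real p"
    using integral_distr[OF m f] geometric_second_moment(2)[OF r] unfolding d
    by (simp add: exponent_measure_def)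
qed

text \<open>A natural number is at most its square, so the constant 8 is inherited.\<close>

lemma exponent_first_moment:
  assumes p: "prime p"
  shows "integrable exponents (\<lambda>\<omega>. real (\<omega> p))"
    and "(\<integral>\<omega>. real (\<omega> p) \<partial>exponents) \<le> 8 / real p"
proof -
  have le: "real n \<le> (real n)\<^sup>2" for n by (cases n) (auto simp: power2_eq_square)
  have m: "(\<lambda>\<omega>. real (\<omega> p)) \<in> borel_measurable exponents"
    by (rule measurable_compose[OF measurable_exponent[OF p]]) (simp add: exponent_measure_def)
  show i: "integrable exponents (\<lambda>\<omega>. real (\<omega> p))"
    by (rule Bochner_Integration.integrable_bound[OF exponent_second_moment(1)[OF p] m]) (use le in auto)
  have "(\<integral>\<omega>. real (\<omega> p) \<partial>exponents) \<le> (\<integral>\<omega>. (real (\<omega> p))\<^sup>2 \<partial>exponents)"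
    by (intro integral_mono i exponent_second_moment le p)
  with exponent_second_moment(2)[OF p] show "(\<integral>\<omega>. real (\<omega> p) \<partial>exponents) \<le> 8 / real p" by linarith
qed

lemma exponent_pair_moment:
  assumes p: "prime p" and q: "prime q" and ne: "p \<noteq> q"
  shows "integrable exponents (\<lambda>\<omega>. real (\<omega> p) * real (\<omega> q))"
    and "(\<integral>\<omega>. real (\<omega> p) * real (\<omega> q) \<partial>exponents) \<le> 8 / real p * (8 / real q)"
proof -
  have "exponents.indep_vars exponent_measure (\<lambda>p \<omega>. \<omega> p) {p, q}"
    by (rule exponents.indep_vars_subset[OF indep_vars_exponents]) (use p q in auto)
  hence iv: "exponents.indep_vars (\<lambda>_. borel) (\<lambda>p \<omega>. real (\<omega> p)) {p, q}"
    by (rule exponents.indep_vars_compose2) (simp add: exponent_measure_def)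
  have i: "integrable exponents (\<lambda>\<omega>. real (\<omega> s))" if "s \<in> {p, q}" for s
    using that p q by (auto intro: exponent_first_moment)
  show "integrable exponents (\<lambda>\<omega>. real (\<omega> p) * real (\<omega> q))"
    using exponents.indep_vars_integrable[OF _ iv i] ne by simp
  have "(\<integral>\<omega>. real (\<omega> p) * real (\<omega> q) \<partial>exponents) = (\<integral>\<omega>. real (\<omega> p) \<partial>exponents) * (\<integral>\<omega>. real (\<omega> q) \<partial>exponents)"
    using exponents.indep_vars_lebesgue_integral[OF _ iv i] ne by simp
  also have "\<dots> \<le> 8 / real p * (8 / real q)"
    by (intro mult_mono exponent_first_moment p q integral_nonneg) auto
  finally show "(\<integral>\<omega>. real (\<omega> p) * real (\<omega> q) \<partial>exponents) \<le> 8 / real p * (8 / real q)" .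
qed

text \<open>Diagonal pairs give the linear term and, by independence, the other pairs the quadratic
  one.\<close>

lemma exponent_sum_second_moment:
  assumes F: "finite F" "\<And>p. p \<in> F \<Longrightarrow> prime p"
  shows "integrable exponents (\<lambda>\<omega>. (\<Sum>p\<in>F. real (\<omega> p))\<^sup>2)"
    and "(\<integral>\<omega>. (\<Sum>p\<in>F. real (\<omega> p))\<^sup>2 \<partial>exponents) \<le> 8 * (\<Sum>p\<in>F. 1 / real p) + 64 * (\<Sum>p\<in>F. 1 / real p)\<^sup>2"
proof -
  have eq: "(\<Sum>p\<in>F. real (\<omega> p))\<^sup>2 = (\<Sum>p\<in>F. \<Sum>q\<in>F. real (\<omega> p) * real (\<omega> q))" for \<omega> :: "nat \<Rightarrow> nat"
    by (simp add: power2_eq_square sum_product)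
  have i: "integrable exponents (\<lambda>\<omega>. real (\<omega> p) * real (\<omega> q))" if "p \<in> F" "q \<in> F" for p q
  proof (cases "p = q")
    case True
    thus ?thesis using exponent_second_moment(1)[of p] that F by (simp add: power2_eq_square)
  qed (use that F exponent_pair_moment in auto)
  show "integrable exponents (\<lambda>\<omega>. (\<Sum>p\<in>F. real (\<omega> p))\<^sup>2)"
    unfolding eq by (intro Bochner_Integration.integrable_sum i)
  \<comment> \<open>The product term is allowed on the diagonal too, so that the double sum
    factors.\<close>
  have bound: "(\<integral>\<omega>. real (\<omega> p) * real (\<omega> q) \<partial>exponents) \<le> (if q = p then 8 / real p else 0) + 8 / real p * (8 / real q)"
    if "p \<in> F" "q \<in> F" for p q
  proof (cases "p = q")
    case True
    have "(\<integral>\<omega>. real (\<omega> p) * real (\<omega> q) \<partial>exponents) \<le> 8 / real p"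
      using exponent_second_moment(2)[of p] that F True by (simp add: power2_eq_square)
    also have "\<dots> \<le> (if q = p then 8 / real p else 0) + 8 / real p * (8 / real q)"
      using True by simp
    finally show ?thesis .
  qed (use that F exponent_pair_moment in auto)
  have "(\<integral>\<omega>. (\<Sum>p\<in>F. real (\<omega> p))\<^sup>2 \<partial>exponents) = (\<Sum>p\<in>F. \<Sum>q\<in>F. (\<integral>\<omega>. real (\<omega> p) * real (\<omega> q) \<partial>exponents))"
    unfolding eq using i by (simp add: Bochner_Integration.integral_sum Bochner_Integration.integrable_sum)
  also have "\<dots> \<le> (\<Sum>p\<in>F. \<Sum>q\<in>F. (if q = p then 8 / real p else 0) + 8 / real p * (8 / real q))"
    by (intro sum_mono bound)
  also have "\<dots> = 8 * (\<Sum>p\<in>F. 1 / real p) + 64 * (\<Sum>p\<in>F. 1 / real p)\<^sup>2"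
  proof -
    have "(\<Sum>p\<in>F. \<Sum>q\<in>F. 8 / real p * (8 / real q)) = (\<Sum>p\<in>F. 8 / real p) * (\<Sum>q\<in>F. 8 / real q)"
      by (simp only: sum_product)
    also have "(\<Sum>p\<in>F. 8 / real p) = 8 * (\<Sum>p\<in>F. 1 / real p)" by (simp add: sum_distrib_left)
    finally show ?thesis
      using F(1) by (simp add: sum.distrib sum_distrib_left[symmetric] power2_eq_square)
         (simp add: sum_distrib_left)
  qed
  finally show "(\<integral>\<omega>. (\<Sum>p\<in>F. real (\<omega> p))\<^sup>2 \<partial>exponents) \<le> 8 * (\<Sum>p\<in>F. 1 / real p) + 64 * (\<Sum>p\<in>F. 1 / real p)\<^sup>2" .
qed

section \<open>Chains in a set of positive density\<close>

text \<open>
  Reverse Fatou for the truncations \<open>min (X j) K\<close>; by the second moment bound truncation lowers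
  each expectation by at most \<open>C / K\<close>.
\<close>

lemma (in prob_space) exists_frequently_ge_limit_of_expectations:
  fixes X :: "nat \<Rightarrow> 'a \<Rightarrow> real"
  assumes meas [measurable]: "\<And>j. X j \<in> borel_measurable M"
    and nonneg: "\<And>j \<omega>. \<omega> \<in> space M \<Longrightarrow> 0 \<le> X j \<omega>"
    and sq: "\<And>j. integrable M (\<lambda>\<omega>. (X j \<omega>)\<^sup>2)" "\<And>j. expectation (\<lambda>\<omega>. (X j \<omega>)\<^sup>2) \<le> C"
    and lim: "c \<longlonglongrightarrow> m" "\<And>j. c j \<le> expectation (X j)"
    and m: "m > 0"
  obtains \<omega> where "\<omega> \<in> space M" "\<And>d. d < m \<Longrightarrow> \<exists>\<^sub>F j in sequentially. d < X j \<omega>"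
proof -
  note goal = that
  define f where "f = (\<lambda>\<omega>. limsup (\<lambda>j. ennreal (X j \<omega>)))"
  have f_meas [measurable]: "f \<in> borel_measurable M" unfolding f_def by measurable
  have int: "integrable M (X j)" for j
    by (rule square_integrable_imp_integrable[OF meas sq(1)])
  have trunc: "ennreal (m - C / K) \<le> (\<integral>\<^sup>+\<omega>. f \<omega> \<partial>M)" if K: "K > 0" for K
  proof -
    \<comment> \<open>Beyond \<open>K\<close> the value \<open>X\<close> is at most
      \<open>X^2 / K\<close>, so \<open>X \<le> min X K + X^2 / K\<close> everywhere; the last term
      has expectation at most \<open>C / K\<close>.\<close>
    have low: "c j - C / K \<le> expectation (\<lambda>\<omega>. min (X j \<omega>) K)" for j
    proof -
      have intmin: "integrable M (\<lambda>\<omega>. min (X j \<omega>) K)" using int by (intro integrable_min) auto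
      have "expectation (X j) \<le> expectation (\<lambda>\<omega>. min (X j \<omega>) K + (X j \<omega>)\<^sup>2 / K)"
      proof (rule integral_mono[OF int])
        show "integrable M (\<lambda>\<omega>. min (X j \<omega>) K + (X j \<omega>)\<^sup>2 / K)"
          using intmin sq(1) by (intro Bochner_Integration.integrable_add) auto
        fix \<omega> assume "\<omega> \<in> space M"
        show "X j \<omega> \<le> min (X j \<omega>) K + (X j \<omega>)\<^sup>2 / K"
        proof (cases "X j \<omega> \<le> K")
          case False
          hence "X j \<omega> * K \<le> (X j \<omega>)\<^sup>2" using K by (simp add: power2_eq_square mult_left_mono)
          hence "X j \<omega> \<le> (X j \<omega>)\<^sup>2 / K" using K by (simp add: field_simps)
          thus ?thesis using False K by simp
        qed (use K in auto)
      qed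
      also have "\<dots> = expectation (\<lambda>\<omega>. min (X j \<omega>) K) + expectation (\<lambda>\<omega>. (X j \<omega>)\<^sup>2) / K"
        using intmin sq(1) by simp
      also have "\<dots> \<le> expectation (\<lambda>\<omega>. min (X j \<omega>) K) + C / K"
        using K sq(2) by (intro add_left_mono divide_right_mono) auto
      finally show ?thesis using lim(2)[of j] by linarith
    qed
    have nn: "ennreal (c j - C / K) \<le> (\<integral>\<^sup>+\<omega>. ennreal (min (X j \<omega>) K) \<partial>M)" for j
    proof -
      have "(\<integral>\<^sup>+\<omega>. ennreal (min (X j \<omega>) K) \<partial>M) = ennreal (expectation (\<lambda>\<omega>. min (X j \<omega>) K))"
        using int nonneg K by (intro nn_integral_eq_integral integrable_min AE_I2) auto
      thus ?thesis using low[of j] by (simp add: ennreal_leI)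
    qed
    have "(\<lambda>j. ennreal (c j - C / K)) \<longlonglongrightarrow> ennreal (m - C / K)"
      by (intro tendsto_ennrealI tendsto_intros lim)
    hence "ennreal (m - C / K) = limsup (\<lambda>j. ennreal (c j - C / K))"
      by (intro lim_imp_Limsup[symmetric]) auto
    also have "\<dots> \<le> limsup (\<lambda>j. \<integral>\<^sup>+\<omega>. ennreal (min (X j \<omega>) K) \<partial>M)"
      by (intro Limsup_mono always_eventually allI nn)
    also have "\<dots> \<le> (\<integral>\<^sup>+\<omega>. limsup (\<lambda>j. ennreal (min (X j \<omega>) K)) \<partial>M)"
      by (rule nn_integral_limsup[where w = "\<lambda>_. ennreal K"]) (auto intro!: AE_I2 ennreal_leI simp: emeasure_space_1)
    also have "\<dots> \<le> (\<integral>\<^sup>+\<omega>. f \<omega> \<partial>M)"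
      unfolding f_def by (intro nn_integral_mono Limsup_mono always_eventually allI ennreal_leI) auto
    finally show ?thesis .
  qed
  \<comment> \<open>The truncation level \<open>K = Suc n\<close> tends to infinity.\<close>
  have "(\<lambda>n. ennreal (m - C / real (Suc n))) \<longlonglongrightarrow> ennreal (m - 0)"
    by (intro tendsto_ennrealI tendsto_diff tendsto_const) (rule LIMSEQ_Suc[OF lim_const_over_n])
  hence ge: "ennreal m \<le> (\<integral>\<^sup>+\<omega>. f \<omega> \<partial>M)"
    by (intro tendsto_upperbound[where F = sequentially and f = "\<lambda>n. ennreal (m - C / real (Suc n))"])
       (auto intro!: trunc always_eventually simp del: of_nat_Suc)
  show thesis
  proof (rule ccontr)
    assume "\<not> thesis"
    \<comment> \<open>If every outcome failed, the limsup would be strictly below \<open>m\<close>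
      everywhere and so would its integral. Strictness at each point is what yields one outcome
      serving all \<open>d < m\<close> at once.\<close>
    have neg: "\<exists>d<m. \<forall>\<^sub>F j in sequentially. X j \<omega> \<le> d" if "\<omega> \<in> space M" for \<omega>
    proof (rule ccontr)
      assume "\<not> (\<exists>d<m. \<forall>\<^sub>F j in sequentially. X j \<omega> \<le> d)"
      hence "\<exists>\<^sub>F j in sequentially. d < X j \<omega>" if "d < m" for d
        using that unfolding frequently_def not_less by blast
      with goal \<open>\<omega> \<in> space M\<close> \<open>\<not> thesis\<close> show False by blast
    qed
    have less: "f \<omega> < ennreal m" if "\<omega> \<in> space M" for \<omega>
    proof -
      obtain d where d: "d < m" "\<forall>\<^sub>F j in sequentially. X j \<omega> \<le> d" using neg \<open>\<omega> \<in> space M\<close> by blast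
      have "f \<omega> \<le> ennreal d" unfolding f_def
        by (rule Limsup_bounded) (use d(2) in \<open>eventually_elim, auto intro: ennreal_leI\<close>)
      also have "\<dots> < ennreal m" using d m by (intro ennreal_lessI) auto
      finally show ?thesis .
    qed
    have const: "(\<integral>\<^sup>+\<omega>. ennreal m \<partial>M) = ennreal m" by (simp add: emeasure_space_1)
    have "(\<integral>\<^sup>+\<omega>. f \<omega> \<partial>M) \<le> (\<integral>\<^sup>+\<omega>. ennreal m \<partial>M)"
      using less by (intro nn_integral_mono) (auto intro: less_imp_le)
    hence fin: "(\<integral>\<^sup>+\<omega>. f \<omega> \<partial>M) \<noteq> \<infinity>" unfolding const by (auto simp: top_unique)
    have "(\<integral>\<^sup>+\<omega>. f \<omega> \<partial>M) < (\<integral>\<^sup>+\<omega>. ennreal m \<partial>M)"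
    proof (rule nn_integral_less[OF _ _ fin])
      show "AE \<omega> in M. f \<omega> \<le> ennreal m" using less by (intro AE_I2) (auto intro: less_imp_le)
      show "\<not> (AE \<omega> in M. ennreal m \<le> f \<omega>)"
      proof
        assume "AE \<omega> in M. ennreal m \<le> f \<omega>"
        hence "AE \<omega> in M. False" using AE_space by eventually_elim (use less in \<open>auto dest: leD\<close>)
        thus False by simp
      qed
    qed auto
    with ge show False unfolding const by simp
  qed
qed

section \<open>Expectation and second moment of the normalised chain count\<close>

definition chain_ratio :: "nat set \<Rightarrow> real \<Rightarrow> (nat \<Rightarrow> nat) \<Rightarrow> real" where
  "chain_ratio A x \<omega> = real (card {a\<in>A. is_prefix \<omega> a \<and> real a \<le> x}) / ln (ln x)"

definition density_ratio :: "nat set \<Rightarrow> real \<Rightarrow> real" where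
  "density_ratio A x = (\<Sum>n\<in>{n\<in>A. 1 < n \<and> real n \<le> x}. 1 / (real n * ln (real n))) / ln (ln x)"

lemma finite_nat_le: "finite {n::nat. Q n \<and> real n \<le> x}"
  by (rule finite_subset[of _ "{..nat \<lfloor>x\<rfloor>}"]) (auto simp: le_nat_floor)

lemma chain_ratio_eq:
  assumes "\<omega> \<in> space exponents"
  shows "chain_ratio A x \<omega> = (\<Sum>a | (a \<in> A \<and> 1 < a) \<and> real a \<le> x. indicator (prefix_event a) \<omega>) / ln (ln x)"
proof -
  have "(\<Sum>a | (a \<in> A \<and> 1 < a) \<and> real a \<le> x. indicator (prefix_event a) \<omega>) =
     (\<Sum>a | a \<in> A \<and> is_prefix \<omega> a \<and> real a \<le> x. 1::real)"
    using assms
    by (intro sum.mono_neutral_cong_right finite_nat_le) (auto simp: prefix_event_def is_prefix_def indicator_def)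
  thus ?thesis by (simp add: chain_ratio_def)
qed

lemma measurable_chain_ratio: "chain_ratio A x \<in> borel_measurable exponents"
proof -
  have "(\<lambda>\<omega>. (\<Sum>a | (a \<in> A \<and> 1 < a) \<and> real a \<le> x. indicator (prefix_event a) \<omega> :: real) / ln (ln x)) \<in> borel_measurable exponents"
    by (intro borel_measurable_divide borel_measurable_sum borel_measurable_indicator sets_prefix_event measurable_const) auto
  thus ?thesis by (rule measurable_cong[THEN iffD2, rotated]) (rule chain_ratio_eq)
qed

lemma expectation_chain_ratio:
  "(\<integral>\<omega>. chain_ratio A x \<omega> \<partial>exponents) =
     (\<Sum>a | (a \<in> A \<and> 1 < a) \<and> real a \<le> x. measure exponents (prefix_event a)) / ln (ln x)"
proof -
  have "(\<integral>\<omega>. chain_ratio A x \<omega> \<partial>exponents) =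
    (\<integral>\<omega>. (\<Sum>a | (a \<in> A \<and> 1 < a) \<and> real a \<le> x. indicator (prefix_event a) \<omega>) / ln (ln x) \<partial>exponents)"
    by (intro Bochner_Integration.integral_cong refl chain_ratio_eq)
  also have "\<dots> = (\<Sum>a | (a \<in> A \<and> 1 < a) \<and> real a \<le> x. measure exponents (prefix_event a)) / ln (ln x)"
    by (subst integral_divide_zero, subst Bochner_Integration.integral_sum)
       (auto intro!: arg_cong2[where f = "(/)"] sum.cong simp: sets_prefix_event exponents.P.emeasure_eq_measure
         dest: sets_prefix_event sets.sets_into_space)
  finally show ?thesis .
qed

lemma ln_ln_at_top: "filterlim (\<lambda>x::real. ln (ln x)) at_top at_top"
  by real_asymp

text \<open>A crude form of \<open>mertens_upper\<close>: the additive constants are absorbed by a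
  second \<open>ln (ln x)\<close>.\<close>

lemma sum_inverse_primes_upper:
  "\<forall>\<^sub>F x in at_top. (\<Sum>p | prime p \<and> real p \<le> x. 1 / real p) \<le> 2 * ln (ln x)"
proof -
  have "\<forall>\<^sub>F x::real in at_top. euler_mascheroni + 1 \<le> ln (ln x)"
    using ln_ln_at_top by (simp add: filterlim_at_top)
  with mertens_upper[of 1, OF zero_less_one] show ?thesis
  proof eventually_elim
    case (elim x)
    have "(\<Sum>p | prime p \<and> real p \<le> x. 1 / real p) \<le> (\<Sum>p | prime p \<and> real p \<le> x. - ln (1 - 1 / real p))"
    proof (rule sum_mono)
      fix p assume "p \<in> {p. prime p \<and> real p \<le> x}"
      hence "1 / real p < 1" using prime_ge_2_nat[of p] by auto
      thus "1 / real p \<le> - ln (1 - 1 / real p)" using ln_le_minus_one[of "1 - 1 / real p"] by simp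
    qed
    thus ?case using elim by linarith
  qed
qed

text \<open>The count is bounded by the sum of the exponents of the primes up to \<open>x\<close>,
  whatever \<open>A\<close> is. This supplies the uniform integrability for reverse Fatou.\<close>

lemma chain_ratio_second_moment:
  "\<forall>\<^sub>F x in at_top. integrable exponents (\<lambda>\<omega>. (chain_ratio A x \<omega>)\<^sup>2) \<and>
     (\<integral>\<omega>. (chain_ratio A x \<omega>)\<^sup>2 \<partial>exponents) \<le> 272"
proof -
  have "\<forall>\<^sub>F x::real in at_top. 1 \<le> ln (ln x)"
    using ln_ln_at_top by (simp add: filterlim_at_top)
  with sum_inverse_primes_upper show ?thesis
  proof eventually_elim
    case (elim x)
    let ?F = "{p. prime p \<and> real p \<le> x}" and ?l = "ln (ln x)"
    let ?S = "\<lambda>\<omega>::nat\<Rightarrow>nat. \<Sum>p\<in>?F. real (\<omega> p)"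
    have l: "?l \<ge> 1" by fact
    have le: "(chain_ratio A x \<omega>)\<^sup>2 \<le> (?S \<omega>)\<^sup>2 / ?l\<^sup>2" for \<omega>
    proof -
      have "card {a\<in>A. is_prefix \<omega> a \<and> real a \<le> x} \<le> (\<Sum>p\<in>?F. \<omega> p)"
        by (rule card_prefixes_le) auto
      hence "real (card {a\<in>A. is_prefix \<omega> a \<and> real a \<le> x}) \<le> ?S \<omega>"
        by (simp flip: of_nat_sum)
      thus ?thesis unfolding chain_ratio_def power_divide
        by (intro divide_right_mono power_mono) auto
    qed
    note S = exponent_sum_second_moment[of ?F, OF finite_primes_le]
    have i: "integrable exponents (\<lambda>\<omega>. (?S \<omega>)\<^sup>2 / ?l\<^sup>2)" using S(1) by simp
    have i2: "integrable exponents (\<lambda>\<omega>. (chain_ratio A x \<omega>)\<^sup>2)"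
      by (rule Bochner_Integration.integrable_bound[OF i])
         (use le measurable_chain_ratio in \<open>auto intro!: borel_measurable_power\<close>)
    have "(\<integral>\<omega>. (chain_ratio A x \<omega>)\<^sup>2 \<partial>exponents) \<le> (\<integral>\<omega>. (?S \<omega>)\<^sup>2 / ?l\<^sup>2 \<partial>exponents)"
      by (intro integral_mono i i2 le)
    also have "\<dots> = (\<integral>\<omega>. (?S \<omega>)\<^sup>2 \<partial>exponents) / ?l\<^sup>2" by simp
    also have "\<dots> \<le> 272"
    proof -
      have H: "0 \<le> (\<Sum>p\<in>?F. 1 / real p)" by (intro sum_nonneg) auto
      have "(\<integral>\<omega>. (?S \<omega>)\<^sup>2 \<partial>exponents) \<le> 8 * (\<Sum>p\<in>?F. 1 / real p) + 64 * (\<Sum>p\<in>?F. 1 / real p)\<^sup>2"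
        using S(2) by simp
      also have "\<dots> \<le> 8 * (2 * ?l) + 64 * (2 * ?l)\<^sup>2"
        using elim H by (intro add_mono mult_left_mono power_mono) auto
      \<comment> \<open>\<open>272 = 8 * 2 + 64 * 4\<close>, with \<open>1 \<le> ln (ln x)\<close>
        raising the linear term to a square.\<close>
      also have "\<dots> \<le> 272 * ?l\<^sup>2"
        using l mult_left_mono[of 1 ?l ?l] by (simp add: power2_eq_square)
      finally show ?thesis using l by (simp add: divide_le_eq)
    qed
    finally show ?case using i2 by blast
  qed
qed

text \<open>The factors \<open>1 - 1 / p\<close> for primes from \<open>P a\<close> to
  \<open>a\<close> are at most 1, so including them only lowers the product and brings it into the
  form estimated by \<open>mertens_upper\<close>.\<close>

lemma prob_prefix_event_ge:
  assumes a: "a > 1"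
  shows "measure exponents (prefix_event a) \<ge>
     1 / real a * exp (- (\<Sum>p | prime p \<and> real p \<le> real a. - ln (1 - 1 / real p)))"
proof -
  let ?A = "{p. prime p \<and> real p \<le> real a}" and ?B = "{p. prime p \<and> p < P a}"
  have lt: "0 < 1 - 1 / real p" "1 - 1 / real p \<le> 1" if "prime p" for p :: nat
    using prime_ge_2_nat[OF that] by auto
  have "exp (- (\<Sum>p | prime p \<and> real p \<le> real a. - ln (1 - 1 / real p))) =
     (\<Prod>p | prime p \<and> real p \<le> real a. 1 - 1 / real p)"
    using lt by (simp add: sum_negf exp_sum finite_primes_le)
  also have "\<dots> = (\<Prod>p\<in>?A - ?B. 1 - 1 / real p) * (\<Prod>p\<in>?B. 1 - 1 / real p)"
    using P_le[OF a] by (intro prod.subset_diff finite_primes_le) auto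
  also have "\<dots> \<le> 1 * (\<Prod>p\<in>?B. 1 - 1 / real p)"
  proof (rule mult_right_mono)
    show "(\<Prod>p\<in>?A - ?B. 1 - 1 / real p) \<le> 1"
      by (intro prod_le_1) (use lt in \<open>force intro: less_imp_le\<close>)
    show "0 \<le> (\<Prod>p\<in>?B. 1 - 1 / real p)"
      by (intro prod_nonneg) (use lt in \<open>force intro: less_imp_le\<close>)
  qed
  finally show ?thesis unfolding prob_prefix_event[OF a]
    by (intro mult_left_mono) auto
qed

text \<open>Mertens gives the termwise bound for \<open>a \<ge> x0\<close>. The smaller
  \<open>a\<close> account for at most a fixed amount \<open>K\<close>, which division by
  \<open>ln (ln x)\<close> makes at most \<open>\<epsilon>\<close>.\<close>

lemma expectation_chain_ratio_ge:
  assumes e: "\<epsilon> > 0"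
  shows "\<forall>\<^sub>F x in at_top. (\<integral>\<omega>. chain_ratio A x \<omega> \<partial>exponents) \<ge>
           exp (- euler_mascheroni - \<epsilon>) * density_ratio A x - \<epsilon>"
proof -
  let ?c = "exp (- euler_mascheroni - \<epsilon>) :: real"
  let ?Q = "\<lambda>x. {a. (a \<in> A \<and> 1 < a) \<and> real a \<le> x}"
  let ?w = "\<lambda>a. 1 / (real a * ln (real a))"
  obtain x0 where x0: "\<And>x. x \<ge> x0 \<Longrightarrow>
     (\<Sum>p | prime p \<and> real p \<le> x. - ln (1 - 1 / real p)) \<le> ln (ln x) + euler_mascheroni + \<epsilon>"
    using mertens_upper[OF e] unfolding eventually_at_top_linorder by blast
  have big: "measure exponents (prefix_event a) \<ge> ?c * ?w a" if "a > 1" "real a \<ge> x0" for a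
  proof -
    have "1 / real a * exp (- (ln (ln (real a)) + euler_mascheroni + \<epsilon>)) \<le> 
      1 / real a * exp (- (\<Sum>p | prime p \<and> real p \<le> real a. - ln (1 - 1 / real p)))"
      using x0[OF that(2)] by (intro mult_left_mono) auto
    also have "\<dots> \<le> measure exponents (prefix_event a)" by (rule prob_prefix_event_ge[OF that(1)])
    also have "exp (- (ln (ln (real a)) + euler_mascheroni + \<epsilon>)) = ?c * exp (- ln (ln (real a)))"
      by (simp add: exp_add[symmetric])
    also have "exp (- ln (ln (real a))) = 1 / ln (real a)"
      using that by (simp add: exp_minus inverse_eq_divide)
    finally show ?thesis by simp
  qed
  define K where "K = (\<Sum>a | (a \<in> A \<and> 1 < a) \<and> real a \<le> x0. ?c * ?w a)"
  have "\<forall>\<^sub>F x::real in at_top. K / \<epsilon> \<le> ln (ln x)" "\<forall>\<^sub>F x::real in at_top. 1 \<le> ln (ln x)"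
    using ln_ln_at_top by (simp_all add: filterlim_at_top)
  thus ?thesis using eventually_ge_at_top[of x0]
  proof eventually_elim
    case (elim x)
    have "?c * (\<Sum>a\<in>?Q x. ?w a) = (\<Sum>a\<in>?Q x. ?c * ?w a)" by (rule sum_distrib_left)
    also have "\<dots> \<le> (\<Sum>a\<in>?Q x. measure exponents (prefix_event a) + (if real a \<le> x0 then ?c * ?w a else 0))"
      using big by (intro sum_mono) (auto simp: not_le less_imp_le)
    also have "\<dots> = (\<Sum>a\<in>?Q x. measure exponents (prefix_event a)) + (\<Sum>a\<in>?Q x. if real a \<le> x0 then ?c * ?w a else 0)"
      by (rule sum.distrib)
    also have "(\<Sum>a\<in>?Q x. if real a \<le> x0 then ?c * ?w a else 0) = K"
      unfolding K_def using elim by (intro sum.mono_neutral_cong_right finite_nat_le) auto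
    finally have "?c * (\<Sum>a\<in>?Q x. ?w a) / ln (ln x) \<le> 
       ((\<Sum>a\<in>?Q x. measure exponents (prefix_event a)) + K) / ln (ln x)"
      using elim by (intro divide_right_mono) auto
    moreover have "K / ln (ln x) \<le> \<epsilon>" using elim e by (simp add: field_simps)
    moreover have "{n \<in> A. 1 < n \<and> real n \<le> x} = ?Q x" by auto
    ultimately show ?case
      unfolding expectation_chain_ratio density_ratio_def by (simp add: add_divide_distrib)
  qed
qed

section \<open>From the density to a single outcome\<close>

lemma less_Limsup_imp_frequently:
  fixes f :: "'a \<Rightarrow> 'b::complete_linorder"
  assumes "c < Limsup F f"
  shows "\<exists>\<^sub>F x in F. c < f x"
proof (rule ccontr)
  assume "\<not> (\<exists>\<^sub>F x in F. c < f x)"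
  hence "\<forall>\<^sub>F x in F. f x \<le> c" by (simp add: not_frequently not_less)
  hence "Limsup F f \<le> c" by (rule Limsup_bounded)
  thus False using assms by simp
qed

lemma ereal_le_Limsup:
  fixes f :: "'a \<Rightarrow> real"
  assumes "\<And>d. d < m \<Longrightarrow> \<exists>\<^sub>F x in F. d < f x"
  shows "ereal m \<le> Limsup F (\<lambda>x. ereal (f x))"
proof (rule ccontr)
  assume "\<not> ereal m \<le> Limsup F (\<lambda>x. ereal (f x))"
  hence "Limsup F (\<lambda>x. ereal (f x)) < ereal m" by simp
  then obtain d where d: "Limsup F (\<lambda>x. ereal (f x)) < ereal d" "ereal d < ereal m"
    using ereal_dense2 by blast
  have "\<forall>\<^sub>F x in F. \<not> d < f x" using Limsup_lessD[OF d(1)] by eventually_elim simp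
  moreover have "\<exists>\<^sub>F x in F. d < f x" using d(2) by (intro assms) simp
  ultimately show False unfolding frequently_def by (rule notE[rotated])
qed

lemma upper_loglog_density_eq:
  "upper_loglog_density A = Limsup at_top (\<lambda>x. ereal (density_ratio A x))"
  unfolding upper_loglog_density_def density_ratio_def by simp

text \<open>Comparison with the expected chain ratio, which ensures that the density is finite. Here
  \<open>274 = 272 + 1 + 1\<close>: the second moment, the 1 in
  \<open>y \<le> 1 + y\<^sup>2\<close>, and \<open>\<epsilon> = 1\<close>.\<close>

lemma density_ratio_bounded: "\<forall>\<^sub>F x in at_top. density_ratio A x \<le> exp (euler_mascheroni + 1) * 274"
  using expectation_chain_ratio_ge[of 1 A, OF zero_less_one] chain_ratio_second_moment[of A]
proof eventually_elim
  case (elim x)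
  have i: "integrable exponents (\<lambda>\<omega>. (chain_ratio A x \<omega>)\<^sup>2)" using elim by blast
  have le: "y \<le> 1 + y\<^sup>2" for y :: real
    using zero_le_power2[of "y - 1/2"] by (simp add: power2_eq_square algebra_simps)
  have "(\<integral>\<omega>. chain_ratio A x \<omega> \<partial>exponents) \<le> (\<integral>\<omega>. 1 + (chain_ratio A x \<omega>)\<^sup>2 \<partial>exponents)"
  proof (rule integral_mono[OF _ _ le])
    show "integrable exponents (chain_ratio A x)"
      by (rule exponents.P.square_integrable_imp_integrable[OF measurable_chain_ratio i])
    show "integrable exponents (\<lambda>\<omega>. 1 + (chain_ratio A x \<omega>)\<^sup>2)" using i by simp
  qed
  also have "\<dots> = 1 + (\<integral>\<omega>. (chain_ratio A x \<omega>)\<^sup>2 \<partial>exponents)"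
    using i by (simp add: exponents.P.prob_space)
  finally have "exp (- euler_mascheroni - 1) * density_ratio A x \<le> 274" using elim by linarith
  hence "exp (euler_mascheroni + 1) * (exp (- euler_mascheroni - 1) * density_ratio A x) \<le> exp (euler_mascheroni + 1) * 274"
    by (intro mult_left_mono) auto
  thus ?case by (simp add: mult.assoc[symmetric] exp_add[symmetric])
qed

text \<open>As \<open>\<epsilon>\<close> tends to 0, the lower bound at density ratio
  \<open>\<Delta> - \<epsilon>\<close> tends to \<open>\<Delta> / exp euler_mascheroni\<close>, so
  the strict inequality for \<open>c\<close> leaves room for some positive
  \<open>\<epsilon>\<close>.\<close>

lemma frequently_expectation_chain_ratio_gt:
  assumes D: "upper_loglog_density A = ereal \<Delta>" and c: "c < \<Delta> / exp euler_mascheroni"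
  shows "\<exists>\<^sub>F x in at_top. c < (\<integral>\<omega>. chain_ratio A x \<omega> \<partial>exponents)"
proof -
  have "((\<lambda>\<epsilon>. exp (- euler_mascheroni - \<epsilon>) * (\<Delta> - \<epsilon>) - \<epsilon>) \<longlongrightarrow> exp (- euler_mascheroni - 0) * (\<Delta> - 0) - 0) (at_right 0)"
    by (intro tendsto_intros)
  moreover have "c < exp (- euler_mascheroni - 0) * (\<Delta> - 0) - 0"
    using c by (simp add: exp_minus field_simps)
  ultimately have "\<forall>\<^sub>F \<epsilon> in at_right 0. c < exp (- euler_mascheroni - \<epsilon>) * (\<Delta> - \<epsilon>) - \<epsilon>"
    by (rule order_tendstoD)
  moreover have "\<forall>\<^sub>F \<epsilon>::real in at_right 0. \<epsilon> > 0" by (simp add: eventually_at_right_less)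
  ultimately have "\<forall>\<^sub>F \<epsilon> in at_right 0. \<epsilon> > 0 \<and> c < exp (- euler_mascheroni - \<epsilon>) * (\<Delta> - \<epsilon>) - \<epsilon>"
    by eventually_elim auto
  then obtain \<epsilon> where e: "\<epsilon> > 0" "c < exp (- euler_mascheroni - \<epsilon>) * (\<Delta> - \<epsilon>) - \<epsilon>"
    using eventually_happens'[OF trivial_limit_at_right_real] by blast
  have "ereal (\<Delta> - \<epsilon>) < Limsup at_top (\<lambda>x. ereal (density_ratio A x))"
    using D e by (simp add: upper_loglog_density_eq)
  from less_Limsup_imp_frequently[OF this] have "\<exists>\<^sub>F x in at_top. \<Delta> - \<epsilon> < density_ratio A x" by simp
  moreover have "\<forall>\<^sub>F x in at_top. \<Delta> - \<epsilon> < density_ratio A x \<longrightarrow> c < (\<integral>\<omega>. chain_ratio A x \<omega> \<partial>exponents)"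
    using expectation_chain_ratio_ge[OF e(1), of A]
  proof eventually_elim
    case (elim x)
    show ?case
    proof
      assume "\<Delta> - \<epsilon> < density_ratio A x"
      hence "exp (- euler_mascheroni - \<epsilon>) * (\<Delta> - \<epsilon>) \<le> exp (- euler_mascheroni - \<epsilon>) * density_ratio A x"
        by (intro mult_left_mono) auto
      thus "c < (\<integral>\<omega>. chain_ratio A x \<omega> \<partial>exponents)" using elim e by linarith
    qed
  qed
  ultimately show ?thesis by (rule frequently_rev_mp)
qed

lemma exists_exponents_chain_ratio:
  assumes D: "upper_loglog_density A = ereal \<Delta>" and pos: "\<Delta> > 0"
  obtains \<omega> where "\<And>d. d < \<Delta> / exp euler_mascheroni \<Longrightarrow> \<exists>\<^sub>F x in at_top. d < chain_ratio A x \<omega>"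
proof -
  define m where "m = \<Delta> / exp euler_mascheroni"
  obtain x0 where x0: "\<And>x. x \<ge> x0 \<Longrightarrow> integrable exponents (\<lambda>\<omega>. (chain_ratio A x \<omega>)\<^sup>2) \<and>
     (\<integral>\<omega>. (chain_ratio A x \<omega>)\<^sup>2 \<partial>exponents) \<le> 272"
    using chain_ratio_second_moment[of A] unfolding eventually_at_top_linorder by blast
  \<comment> \<open>\<open>x0\<close> secures the second moment bound, \<open>exp 1\<close> keeps
    \<open>ln (ln x)\<close> nonnegative, and \<open>real j\<close> forces the chosen points to
    infinity.\<close>
  have "\<exists>x. x \<ge> max (max x0 (exp 1)) (real j) \<and> m - 1 / real (Suc j) < (\<integral>\<omega>. chain_ratio A x \<omega> \<partial>exponents)" for j
  proof -
    have "\<exists>\<^sub>F x in at_top. m - 1 / real (Suc j) < (\<integral>\<omega>. chain_ratio A x \<omega> \<partial>exponents)"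
      by (rule frequently_expectation_chain_ratio_gt[OF D]) (simp add: m_def)
    from frequently_eventually_conj[OF this eventually_ge_at_top[of "max (max x0 (exp 1)) (real j)"]]
    show ?thesis by (auto dest: frequently_ex)
  qed
  then obtain x where x: "\<And>j. x j \<ge> max (max x0 (exp 1)) (real j)"
     "\<And>j. m - 1 / real (Suc j) < (\<integral>\<omega>. chain_ratio A (x j) \<omega> \<partial>exponents)" by metis
  have xlim: "filterlim x at_top sequentially"
    by (rule filterlim_at_top_mono[OF filterlim_real_sequentially]) (use x(1) in \<open>auto intro!: always_eventually\<close>)
  have "(\<lambda>j. m - 1 / real (Suc j)) \<longlonglongrightarrow> m - 0"
    by (intro tendsto_diff tendsto_const) (rule LIMSEQ_Suc[OF lim_const_over_n])
  hence lim: "(\<lambda>j. m - 1 / real (Suc j)) \<longlonglongrightarrow> m" by simp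
  have nonneg: "0 \<le> chain_ratio A (x j) \<omega>" for j \<omega>
  proof -
    have "exp 1 \<le> x j" using x(1)[of j] by simp
    hence "1 \<le> ln (x j)" using exp_gt_zero[of "1::real"] by (subst ln_ge_iff) linarith+
    thus ?thesis by (simp add: chain_ratio_def)
  qed
  obtain \<omega> where w: "\<omega> \<in> space exponents" "\<And>d. d < m \<Longrightarrow> \<exists>\<^sub>F j in sequentially. d < chain_ratio A (x j) \<omega>"
  proof (rule exponents.P.exists_frequently_ge_limit_of_expectations[of "\<lambda>j. chain_ratio A (x j)" 272 _ m])
    show "(\<lambda>j. m - 1 / real (Suc j)) \<longlonglongrightarrow> m" by (fact lim)
  qed (use x x0 nonneg pos in \<open>auto simp: measurable_chain_ratio m_def less_imp_le\<close>)
  have freq: "\<exists>\<^sub>F x in at_top. d < chain_ratio A x \<omega>" if "d < m" for d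
  proof (rule ccontr)
    assume "\<not> (\<exists>\<^sub>F x in at_top. d < chain_ratio A x \<omega>)"
    hence "\<forall>\<^sub>F x in at_top. \<not> d < chain_ratio A x \<omega>" by (simp add: frequently_def)
    hence "\<forall>\<^sub>F j in sequentially. \<not> d < chain_ratio A (x j) \<omega>" using xlim by (rule eventually_compose_filterlim)
    with w(2)[OF that] show False unfolding frequently_def by (rule notE)
  qed
  show thesis by (rule that, rule freq) (simp add: m_def)
qed

theorem theorem1p10:
  fixes A :: "nat set"
  assumes "upper_loglog_density A > 0"
  shows "\<exists>d. L_chain d \<and> range d \<subseteq> A \<and>
           Limsup at_top (\<lambda>y::real. ereal (real (card {k \<in> range d. real k \<le> y}) / ln (ln y)))
             \<ge> upper_loglog_density A / ereal (exp euler_mascheroni)"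
proof -
  \<comment> \<open>Finiteness allows the density to be treated as a real number
    \<open>\<Delta>\<close>.\<close>
  have "upper_loglog_density A \<le> ereal (exp (euler_mascheroni + 1) * 274)"
    unfolding upper_loglog_density_eq
    by (rule Limsup_bounded) (use density_ratio_bounded[of A] in simp)
  then obtain \<Delta> where D: "upper_loglog_density A = ereal \<Delta>" "\<Delta> > 0"
    using assms by (cases "upper_loglog_density A") auto
  define m where "m = \<Delta> / exp euler_mascheroni"
  have m: "m > 0" using D by (simp add: m_def)
  obtain \<omega> where w: "\<And>d. d < m \<Longrightarrow> \<exists>\<^sub>F x in at_top. d < chain_ratio A x \<omega>"
    using exists_exponents_chain_ratio[OF D] unfolding m_def by blast
  define S where "S = {a\<in>A. is_prefix \<omega> a}"
  have ratio: "chain_ratio A x \<omega> = real (card {k \<in> S. real k \<le> x}) / ln (ln x)" for x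
    unfolding chain_ratio_def S_def by (simp add: conj_assoc)
  \<comment> \<open>For finite \<open>S\<close> the ratio would tend to 0, although it exceeds
    \<open>m / 2\<close> at arbitrarily large \<open>x\<close>.\<close>
  have inf: "infinite S"
  proof
    assume fin: "finite S"
    have "((\<lambda>x::real. real (card S) / ln (ln x)) \<longlongrightarrow> 0) at_top"
      by (rule tendsto_divide_0[OF tendsto_const]) (rule filterlim_at_top_imp_at_infinity[OF ln_ln_at_top])
    hence "\<forall>\<^sub>F x::real in at_top. real (card S) / ln (ln x) < m / 2"
      using m by (intro order_tendstoD) auto
    moreover have "\<forall>\<^sub>F x::real in at_top. 1 \<le> ln (ln x)"
      using ln_ln_at_top by (simp add: filterlim_at_top)
    ultimately have "\<forall>\<^sub>F x in at_top. \<not> m / 2 < chain_ratio A x \<omega>"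
    proof eventually_elim
      case (elim x)
      have "card {k \<in> S. real k \<le> x} \<le> card S" using fin by (intro card_mono) auto
      hence "chain_ratio A x \<omega> \<le> real (card S) / ln (ln x)"
        unfolding ratio using elim by (intro divide_right_mono) auto
      thus ?case using elim by linarith
    qed
    moreover have "\<exists>\<^sub>F x in at_top. m / 2 < chain_ratio A x \<omega>" using m by (intro w) auto
    ultimately show False unfolding frequently_def by (rule notE[rotated])
  qed
  \<comment> \<open>Any prefix lies in \<open>L\<close> of any smaller one, so the increasing
    enumeration remains a chain although prefixes outside \<open>A\<close> are skipped.\<close>
  define d where "d = enumerate S"
  have range: "range d = S" unfolding d_def using inf by (rule range_enumerate)
  have mono: "strict_mono d" unfolding d_def using inf by (rule strict_mono_enumerate)
  have "d j \<in> S" for j using range by auto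
  hence pref: "is_prefix \<omega> (d j)" for j by (simp add: S_def)
  have "L_chain d"
    unfolding L_chain_def
  proof (intro conjI allI mono)
    show "1 < d 0" using pref[of 0] by (simp add: is_prefix_def)
    show "d (Suc j) \<in> L (d j)" for j
      using mono by (intro is_prefix_less_imp_L[OF pref pref]) (simp add: strict_mono_Suc_iff)
  qed
  moreover have "range d \<subseteq> A" unfolding range by (auto simp: S_def)
  moreover have "ereal m \<le> Limsup at_top (\<lambda>x. ereal (chain_ratio A x \<omega>))"
    by (rule ereal_le_Limsup[OF w])
  moreover have "upper_loglog_density A / ereal (exp euler_mascheroni) = ereal m"
    by (simp add: D m_def)
  ultimately show ?thesis
    unfolding ratio range[symmetric] by (intro exI[of _ d]) simp
qed

end
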